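(* Let $G$ be a digraph with vertex set $\{1,2,\dots,n\}$, and let $\overrightarrow{G}=G[H_1,H_2,\dots,H_n]$ be a generalized join digraph with respect to $G$ with $|V(H_i)|=m_i$ for each $1\le i\le n$, where $H_i=a_iK_2\cup b_iK_1$ consists of an oriented matching with $a_i$ edges together with $b_i$ isolated vertices ($a_i,b_i$ nonnegative integers, $m_i=2a_i+b_i$). Label $V(H_i)=\{v_i^1,\dots,v_i^{m_i}\}$ so that the edges of $H_i$ are exactly $(v_i^{2s-1},v_i^{2s})$ for $1\le s\le a_i$, and $v_i^{2a_i+1},\dots,v_i^{2a_i+b_i}$ are isolated in $H_i$. Let $i^*\in V(G)$ and set $z_i(\overrightarrow{G})=\sum_{j:\,(i,j)\in E(G)}m_j$ for each $i\in V(G)$. (1) If $1\le p\le 2a_{i^*}$ is odd, then $$t_{v_{i^*}^p}(\overrightarrow{G})=\frac{z_{i^*}(\overrightarrow{G})}{m_{i^*}+m_{i^*}z_{i^*}(\overrightarrow{G})}\prod_{i\in V(G)}z_i(\overrightarrow{G})^{m_i-a_i-1}\left(1+z_i(\overrightarrow{G})\right)^{a_i}\sum_{T\in\mathcal{T}_{i^*}(G)}\prod_{(i,j)\in E(T)}m_j .$$ (2) If $1\le p\le 2a_{i^*}$ is even, then $$t_{v_{i^*}^p}(\overrightarrow{G})=\frac{2+z_{i^*}(\overrightarrow{G})}{m_{i^*}+m_{i^*}z_{i^*}(\overrightarrow{G})}\prod_{i\in V(G)}z_i(\overrightarrow{G})^{m_i-a_i-1}\left(1+z_i(\overrightarrow{G})\right)^{a_i}\sum_{T\in\mathcal{T}_{i^*}(G)}\prod_{(i,j)\in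 E(T)}m_j .$$ (3) If $2a_{i^*}+1\le p\le m_{i^*}$, then $$t_{v_{i^*}^p}(\overrightarrow{G})=\frac{1}{m_{i^*}}\prod_{i\in V(G)}z_i(\overrightarrow{G})^{m_i-a_i-1}\left(1+z_i(\overrightarrow{G})\right)^{a_i}\sum_{T\in\mathcal{T}_{i^*}(G)}\prod_{(i,j)\in E(T)}m_j .$$
   Context: Digraphs are finite, with nonempty vertex set (so $m_i\ge 1$), without loops or multiple edges (both $(u,v)$ and $(v,u)$ may be edges); $(u,v)$ is directed from $u$ to $v$. Generalized join digraph: $G[H_1,\dots,H_n]$ is obtained from $G$ by replacing each vertex $i$ with $H_i$: its vertex set is the disjoint union $V(H_1)\cup\dots\cup V(H_n)$, the edges inside each $H_i$ are kept, and for $i\ne j$, $u\in V(H_i)$, $v\in V(H_j)$, $(u,v)$ is an edge if and only if $(i,j)\in E(G)$. An oriented spanning tree of a digraph is a subtree containing all its vertices, in which one vertex, the root, has outdegree $0$ and every other vertex has outdegree $1$. $\mathcal{T}_v(G)$ is the set of oriented spanning trees of $G$ with root $v$, and $t_v(G)=|\mathcal{T}_v(G)|$. Empty products equal $1$ and $0^0=1$. *)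

theory Defs
  imports Complex_Main "Graph_Theory.Graph_Theory"
begin

text \<open>
  Digraphs without loops or multiple arcs are the \<^locale>\<open>pair_digraph\<close>s of the Graph\_Theory entry;
  nonemptiness of the vertex set is not part of that locale.
\<close>

text \<open>The disjoint union of the vertex sets is realised by tagging each vertex of \<open>H i\<close> with \<open>i\<close>.\<close>

definition generalized_join ::
  "'i pair_pre_digraph \<Rightarrow> ('i \<Rightarrow> 'a pair_pre_digraph) \<Rightarrow> ('i \<times> 'a) pair_pre_digraph" where
  "generalized_join G H =
    \<lparr> pverts = (SIGMA i : pverts G. pverts (H i)),
      parcs = {((i, u), (j, w)) | i u j w.
        i \<in> pverts G \<and> j \<in> pverts G \<and> u \<in> pverts (H i) \<and> w \<in> pverts (H j) \<and>
        (i = j \<and> (u, w) \<in> parcs (H i) \<or> i \<noteq> j \<and> (i, j) \<in> parcs G)} \<rparr>"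

text \<open>
  The underlying undirected graph is a tree. The library predicate \<^const>\<open>tree\<close> only excludes
  directed cycles, so it is not used. In \<^const>\<open>mk_symmetric\<close> every edge together with its
  reverse is a cycle of length 2, hence the bound on the length; a pair of opposite arcs, which is a
  2-cycle of the underlying multigraph, is excluded separately.
\<close>

definition underlying_tree :: "'a pair_pre_digraph \<Rightarrow> bool" where
  "underlying_tree T \<longleftrightarrow>
     connected (with_proj T) \<and>
     (\<forall>u w. (u, w) \<in> parcs T \<longrightarrow> (w, u) \<notin> parcs T) \<and>
     \<not> (\<exists>c. pre_digraph.cycle (with_proj (mk_symmetric (with_proj T))) c \<and> 3 \<le> length c)"

definition oriented_spanning_trees :: "'a pair_pre_digraph \<Rightarrow> 'a \<Rightarrow> 'a pair_pre_digraph set" where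
  "oriented_spanning_trees G r =
     {T. spanning (with_proj T) (with_proj G) \<and> underlying_tree T \<and>
         r \<in> pverts T \<and> out_degree (with_proj T) r = 0 \<and>
         (\<forall>u \<in> pverts T - {r}. out_degree (with_proj T) u = 1)}"

definition num_oriented_spanning_trees :: "'a pair_pre_digraph \<Rightarrow> 'a \<Rightarrow> nat" where
  "num_oriented_spanning_trees G r = card (oriented_spanning_trees G r)"

definition out_weight :: "'i pair_pre_digraph \<Rightarrow> ('i \<Rightarrow> nat) \<Rightarrow> 'i \<Rightarrow> nat" where
  "out_weight G m i = (\<Sum>j | (i, j) \<in> parcs G. m j)"

end

theory Submission
  imports Defs "HOL-Library.FuncSet"
begin

text \<open>
  An oriented spanning tree with root \<open>r\<close> is a function on the other vertices whose iteration leads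
  to \<open>r\<close>, so tree counts are special cases of a weighted sum over such functions. Let \<open>x\<close> and \<open>y\<close> be
  two non-root vertices with the same outgoing weights \<open>p\<close>, except for an additional arc of weight
  \<open>\<epsilon>\<close> from \<open>x\<close> to \<open>y\<close>. Fix the arcs out of all other vertices, and let \<open>R\<close>, \<open>X\<close>, \<open>Y\<close> be the
  components that drain into the roots, \<open>x\<close> and \<open>y\<close>. The admissible arcs out of \<open>x\<close> and \<open>y\<close> have
  total weight
  \<open>p(R) p(R) + p(R) (p(Y) + \<epsilon>) + p(X) p(R) = (p(R) + p(X) + p(Y) + \<epsilon>) p(R)\<close>,
  hence merging \<open>x\<close> and \<open>y\<close> divides the sum by the constant \<open>z + \<epsilon>\<close>, where \<open>z\<close> is the total weight
  of \<open>p\<close>. When one of the two is the root, redirecting the last arc of a walk shows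
  that the two components share the forests in proportion to the weights of their roots. Merging
  first the matched pairs (\<open>\<epsilon> = 1\<close>) and then all vertices of each \<open>H\<^sub>i\<close> (\<open>\<epsilon> = 0\<close>) leaves the weighted
  digraph \<open>G\<close>.
\<close>

section \<open>Spanning forests as functions\<close>

text \<open>The walk along \<open>f\<close> from \<open>v\<close> stops at its first visit to
  \<open>R\<close>, and \<open>r\<close> is where it stops. Being inductive, the predicate also
  asserts termination, so a cycle avoiding \<open>R\<close> leads nowhere.\<close>

inductive leads :: "('a \<Rightarrow> 'a) \<Rightarrow> 'a set \<Rightarrow> 'a \<Rightarrow> 'a \<Rightarrow> bool" for f R where
  root: "v \<in> R \<Longrightarrow> leads f R v v"
| step: "v \<notin> R \<Longrightarrow> leads f R (f v) r \<Longrightarrow> leads f R v r"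

text \<open>Extensionality makes each forest correspond to exactly one function; termination of all
  walks is what excludes cycles.\<close>

definition forests :: "'a set \<Rightarrow> 'a set \<Rightarrow> ('a \<Rightarrow> 'a) set" where
  "forests V R = {f \<in> (V - R) \<rightarrow>\<^sub>E V. \<forall>v\<in>V. \<exists>r. leads f R v r}"

text \<open>For finite \<open>V\<close> and \<open>R \<subseteq> V\<close> this is, by the
  matrix-tree theorem, the principal minor of the weighted Laplacian of \<open>P\<close> with the
  rows and columns in \<open>R\<close> deleted.\<close>

definition forest_sum :: "'a set \<Rightarrow> 'a set \<Rightarrow> ('a \<Rightarrow> 'a \<Rightarrow> real) \<Rightarrow> real" where
  "forest_sum V R P = (\<Sum>f\<in>forests V R. \<Prod>u\<in>V - R. P u (f u))"

lemma leads_in_roots: "leads f R v r \<Longrightarrow> r \<in> R"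
  by (induction rule: leads.induct)

lemma leads_root_iff: "v \<in> R \<Longrightarrow> leads f R v r \<longleftrightarrow> r = v"
  by (auto intro: leads.root elim: leads.cases)

lemma leads_step_iff: "v \<notin> R \<Longrightarrow> leads f R v r \<longleftrightarrow> leads f R (f v) r"
  by (auto intro: leads.step elim: leads.cases)

lemma leads_unique: "leads f R v r \<Longrightarrow> leads f R v r' \<Longrightarrow> r = r'"
  by (induction rule: leads.induct) (auto simp: leads_root_iff leads_step_iff)

lemma leads_cong:
  assumes "leads f R v r" "\<And>u. u \<notin> R \<Longrightarrow> f u = g u"
  shows "leads g R v r"
  using assms(1) by (induction rule: leads.induct) (metis assms(2) leads.simps)+

lemma forestsD:
  assumes "f \<in> forests V R"
  shows "f \<in> (V - R) \<rightarrow>\<^sub>E V" "\<And>u. u \<in> V \<Longrightarrow> u \<notin> R \<Longrightarrow> f u \<in> V"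
    "\<And>v. v \<in> V \<Longrightarrow> \<exists>r. leads f R v r"
  using assms by (auto simp: forests_def)

lemma finite_forests: "finite V \<Longrightarrow> finite (forests V R)"
  by (rule finite_subset[of _ "(V - R) \<rightarrow>\<^sub>E V"]) (auto simp: forests_def intro: finite_PiE)

section \<open>Turning a vertex into a root, and giving a root an arc\<close>

lemma leads_insert_imp:
  assumes "leads f R v r"
  shows "leads f (insert x R) v x \<or> leads f (insert x R) v r"
  using assms by (induction rule: leads.induct) (metis insert_iff leads.simps)+

lemma leads_insert_other:
  assumes "leads f (insert x R) v r" "r \<noteq> x"
  shows "leads f R v r"
  using assms by (induction rule: leads.induct) (metis insert_iff leads.simps)+

text \<open>Concatenation of two walks at \<open>x\<close>. The endpoint is a separate variable
  \<open>y\<close> with \<open>y = x\<close>, so that rule induction applies.\<close>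

lemma leads_insert_new:
  assumes "leads f (insert x R) v y" "y = x" "leads f R x r"
  shows "leads f R v r"
  using assms by (induction rule: leads.induct) (auto intro: leads.intros)

text \<open>If \<open>f x\<close> leads back to \<open>x\<close>, then \<open>x\<close> lies on a
  cycle avoiding \<open>R\<close>, and a walk visiting it can never reach \<open>R\<close>.\<close>

lemma not_leads_insert_cycle:
  assumes "leads f R v r" "x \<notin> R" "leads f (insert x R) (f x) x"
  shows "\<not> leads f (insert x R) v x"
  using assms(1)
proof (induction rule: leads.induct)
  case (root v)
  then show ?case using assms(2) by (auto simp: leads_root_iff)
next
  case (step v r)
  then show ?case using assms(3) by (cases "v = x") (auto simp: leads_step_iff)
qed

lemma leads_upd:
  "leads (g(x := s)) (insert x R) = leads g (insert x R)"
  by (intro ext iffI; erule leads_cong) auto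

text \<open>The new arc from \<open>x\<close> to \<open>s\<close> closes a cycle exactly when
  \<open>s\<close> lies in the component of \<open>x\<close>. Otherwise \<open>s\<close> drains into
  a root in \<open>R\<close>, and the component of \<open>x\<close> follows it.\<close>

lemma forests_upd_iff:
  assumes "x \<in> V - R" "R \<subseteq> V" "s \<in> V" "g \<in> (V - insert x R) \<rightarrow>\<^sub>E V"
  shows "g(x := s) \<in> forests V R \<longleftrightarrow>
    g \<in> forests V (insert x R) \<and> (\<exists>r\<in>R. leads g (insert x R) s r)"
proof -
  let ?f = "g(x := s)"
  have pie: "?f \<in> (V - R) \<rightarrow>\<^sub>E V"
    using assms by (auto simp: PiE_iff extensional_def)
  show ?thesis
  proof
    assume f: "?f \<in> forests V R"
    have lf: "\<exists>r. leads ?f R v r" if "v \<in> V" for v using f that by (auto simp: forests_def)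
    have g: "\<exists>r. leads g (insert x R) v r" if "v \<in> V" for v
      using lf[OF that] leads_insert_imp[of ?f R v _ x] by (auto simp: leads_upd)
    obtain r where r: "leads ?f R s r" using lf assms(3) by blast
    have "\<not> leads ?f (insert x R) s x"
    proof
      assume "leads ?f (insert x R) s x"
      with not_leads_insert_cycle[OF r, of x] assms(1) show False by auto
    qed
    with leads_insert_imp[OF r, of x] have "leads g (insert x R) s r" by (auto simp: leads_upd)
    with g leads_in_roots[OF r] show "g \<in> forests V (insert x R) \<and> (\<exists>r\<in>R. leads g (insert x R) s r)"
      using assms(4) by (auto simp: forests_def)
  next
    assume a: "g \<in> forests V (insert x R) \<and> (\<exists>r\<in>R. leads g (insert x R) s r)"
    then obtain r where r: "r \<in> R" "leads ?f (insert x R) s r" by (auto simp: leads_upd)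
    with assms(1) have sr: "leads ?f R s r" by - (rule leads_insert_other[of _ x], auto)
    have xr: "leads ?f R x r" using assms(1) sr by - (rule leads.step, auto)
    have "\<exists>r. leads ?f R v r" if v: "v \<in> V" for v
    proof -
      obtain r' where r': "leads ?f (insert x R) v r'" using a v by (auto simp: forests_def leads_upd)
      show ?thesis
        using leads_insert_other[OF r'] leads_insert_new[OF _ refl xr] r' by (cases "r' = x") auto
    qed
    with pie show "?f \<in> forests V R" by (auto simp: forests_def)
  qed
qed

text \<open>The arc from \<open>x\<close> to \<open>s\<close> attaches the component of
  \<open>x\<close> to that of \<open>s\<close> and leaves all other walks as they were.\<close>

lemma leads_upd_iff:
  assumes "x \<notin> R" "g(x := s) \<in> forests V R" "s \<in> V" "v \<in> V"
  shows "leads (g(x := s)) R v r \<longleftrightarrow>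
    (r \<in> R \<and> leads g (insert x R) v r) \<or>
    (leads g (insert x R) v x \<and> r \<in> R \<and> leads g (insert x R) s r)"
proof -
  let ?f = "g(x := s)"
  obtain r0 where r0: "leads ?f R s r0" using assms(2,3) by (auto simp: forests_def)
  have xr: "leads ?f R x r0" using assms(1) r0 by - (rule leads.step, auto)
  have nc: "\<not> leads ?f (insert x R) s x"
    using not_leads_insert_cycle[OF r0, of x] assms(1) by auto
  have s: "leads g (insert x R) s r0"
    using leads_insert_imp[OF r0, of x] nc by (auto simp: leads_upd)
  show ?thesis
  proof
    assume l: "leads ?f R v r"
    have "r = r0" if "leads g (insert x R) v x"
      using leads_insert_new[OF _ refl xr, of v] that leads_unique[OF l] by (auto simp: leads_upd)
    then show "(r \<in> R \<and> leads g (insert x R) v r) \<or>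
      (leads g (insert x R) v x \<and> r \<in> R \<and> leads g (insert x R) s r)"
      using leads_insert_imp[OF l, of x] leads_in_roots[OF l] s by (auto simp: leads_upd)
  next
    assume "(r \<in> R \<and> leads g (insert x R) v r) \<or>
      (leads g (insert x R) v x \<and> r \<in> R \<and> leads g (insert x R) s r)"
    then show "leads ?f R v r"
    proof (elim disjE conjE)
      assume "r \<in> R" "leads g (insert x R) v r"
      then show ?thesis using assms(1) by - (rule leads_insert_other[of _ x], auto simp: leads_upd)
    next
      assume "leads g (insert x R) v x" "leads g (insert x R) s r"
      then show ?thesis using leads_insert_new[OF _ refl xr, of v] leads_unique[OF s] by (auto simp: leads_upd)
    qed
  qed
qed

text \<open>Deleting the arc out of \<open>x\<close> is a bijection from the forests with roots
  \<open>R\<close> to the pairs of a forest with \<open>x\<close> as additional root and a head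
  \<open>s\<close> outside the component of \<open>x\<close>.\<close>

lemma sum_forests_split:
  fixes \<Phi> :: "('a \<Rightarrow> 'a) \<Rightarrow> real"
  assumes "finite V" "x \<in> V - R" "R \<subseteq> V"
  shows "(\<Sum>f\<in>forests V R. \<Phi> f) =
    (\<Sum>g\<in>forests V (insert x R). \<Sum>s | s \<in> V \<and> (\<exists>r\<in>R. leads g (insert x R) s r). \<Phi> (g(x := s)))"
proof -
  have "(\<Sum>g\<in>forests V (insert x R). \<Sum>s | s \<in> V \<and> (\<exists>r\<in>R. leads g (insert x R) s r). \<Phi> (g(x := s)))
    = (\<Sum>(g, s)\<in>(SIGMA g:forests V (insert x R). {s \<in> V. \<exists>r\<in>R. leads g (insert x R) s r}). \<Phi> (g(x := s)))"
    using assms(1) by (intro sum.Sigma) (auto simp: finite_forests)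
  also have "\<dots> = (\<Sum>f\<in>forests V R. \<Phi> f)"
  \<comment> \<open>Besides recording the head \<open>f x\<close>, one direction resets the value at
    \<open>x\<close> to \<open>undefined\<close>, as \<open>x\<close> is now a root and forests are
    extensional.\<close>
  proof (rule sum.reindex_bij_witness[of _ "\<lambda>f. (f(x := undefined), f x)" "\<lambda>(g, s). g(x := s)"], goal_cases)
    case (1 a)
    then obtain g s where a: "a = (g, s)" "g \<in> forests V (insert x R)" by auto
    then have "g x = undefined" using assms by (auto simp: forests_def PiE_iff extensional_def)
    then show ?case using a by (auto simp: fun_eq_iff)
  next
    case (2 a)
    then show ?case using assms forests_upd_iff[of x V R] by (auto simp: forestsD(1))
  next
    case (3 f)
    then show ?case by auto
  next
    case (4 f)
    then have "f(x := undefined) \<in> (V - insert x R) \<rightarrow>\<^sub>E V" "f x \<in> V"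
      using assms by (auto simp: forests_def PiE_iff extensional_def)
    then show ?case using forests_upd_iff[of x V R "f x" "f(x := undefined)"] 4 assms by auto
  qed auto
  finally show ?thesis ..
qed

section \<open>Transport of forests along a map of vertices\<close>

lemma leads_transport:
  assumes "leads g R v r" "v \<in> V" "\<And>u. u \<in> V \<Longrightarrow> u \<in> R \<longleftrightarrow> \<mu> u \<in> R'"
    "\<And>u. u \<in> V - R \<Longrightarrow> g u \<in> V" "\<And>u. u \<in> V - R \<Longrightarrow> g' (\<mu> u) = \<mu> (g u)"
  shows "leads g' R' (\<mu> v) (\<mu> r)"
  using assms(1,2)
proof (induction rule: leads.induct)
  case (root v)
  then show ?case using assms(3) by (auto intro: leads.root)
next
  case (step v r)
  then show ?case using assms(3,4,5) by (metis DiffI leads.step)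
qed

text \<open>A walk in the image lifts step by step from a given start \<open>v\<close>. Several
  roots may lie over \<open>r'\<close>; \<open>g\<close> decides which of them is reached.\<close>

lemma leads_transport_back:
  assumes "leads g' R' v' r'" "v' = \<mu> v" "v \<in> V" "\<And>u. u \<in> V \<Longrightarrow> u \<in> R \<longleftrightarrow> \<mu> u \<in> R'"
    "\<And>u. u \<in> V - R \<Longrightarrow> g u \<in> V" "\<And>u. u \<in> V - R \<Longrightarrow> g' (\<mu> u) = \<mu> (g u)"
  shows "\<exists>r. leads g R v r \<and> \<mu> r = r'"
  using assms(1,2,3)
proof (induction arbitrary: v rule: leads.induct)
  case (root v')
  then show ?case using assms(4) by (auto intro: leads.root)
next
  case (step v' r')
  then have "v \<in> V - R" using assms(4) by auto
  with step obtain r where "leads g R (g v) r \<and> \<mu> r = r'"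
    using assms(5,6) by metis
  then show ?case using \<open>v \<in> V - R\<close> by (auto intro: leads.step)
qed

text \<open>\<mu> is bijective on non-roots but may identify roots. A lift of \<open>g'\<close>
  chooses, independently for each non-root \<open>u\<close>, a head over
  \<open>g' (\<mu> u)\<close>; summing over all lifts turns the weights \<open>P\<close> into the
  sums \<open>P'\<close>, provided that \<Phi> is constant on lifts.\<close>

lemma sum_forests_transport:
  fixes \<Phi> \<Phi>' :: "_ \<Rightarrow> real"
  assumes fin: "finite V" "finite V'"
    and bij: "bij_betw \<mu> (V - R) (V' - R')"
    and maps: "\<And>u. u \<in> V \<Longrightarrow> \<mu> u \<in> V'" "\<And>u. u \<in> V \<Longrightarrow> u \<in> R \<longleftrightarrow> \<mu> u \<in> R'"
    and P: "\<And>u s'. u \<in> V - R \<Longrightarrow> s' \<in> V' \<Longrightarrow> P' (\<mu> u) s' = (\<Sum>t | t \<in> V \<and> \<mu> t = s'. P u t)"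
    and \<Phi>: "\<And>g g'. g \<in> forests V R \<Longrightarrow> g' \<in> forests V' R' \<Longrightarrow>
        (\<And>u. u \<in> V - R \<Longrightarrow> g' (\<mu> u) = \<mu> (g u)) \<Longrightarrow> \<Phi> g = \<Phi>' g'"
  shows "(\<Sum>g\<in>forests V R. (\<Prod>u\<in>V - R. P u (g u)) * \<Phi> g) =
    (\<Sum>g'\<in>forests V' R'. (\<Prod>u\<in>V' - R'. P' u (g' u)) * \<Phi>' g')"
proof -
  \<comment> \<open>\<open>?B g' u\<close> holds the possible heads of \<open>u\<close> in a lift,
    and \<open>?Fib g'\<close> is the set of all lifts of \<open>g'\<close>.\<close>
  let ?B = "\<lambda>g' u. {t \<in> V. \<mu> t = g' (\<mu> u)}"
  let ?Fib = "\<lambda>g'. PiE (V - R) (?B g')"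
  have fib_iff: "g \<in> ?Fib g' \<longleftrightarrow> g \<in> (V - R) \<rightarrow>\<^sub>E V \<and> (\<forall>u\<in>V - R. g' (\<mu> u) = \<mu> (g u))" for g g'
    by (auto simp: PiE_iff)
  have fib_forest: "g \<in> forests V R" if "g \<in> ?Fib g'" "g' \<in> forests V' R'" for g g'
  proof -
    have *: "g \<in> (V - R) \<rightarrow>\<^sub>E V" "\<And>u. u \<in> V - R \<Longrightarrow> g u \<in> V" "\<And>u. u \<in> V - R \<Longrightarrow> g' (\<mu> u) = \<mu> (g u)"
      using that(1) unfolding fib_iff by auto
    have "\<exists>r. leads g R v r" if v: "v \<in> V" for v
    proof -
      obtain r' where "leads g' R' (\<mu> v) r'" using \<open>g' \<in> forests V' R'\<close> maps(1)[OF v] by (auto simp: forests_def)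
      from leads_transport_back[OF this refl v maps(2) *(2,3)] show ?thesis by blast
    qed
    with * show ?thesis by (auto simp: forests_def)
  qed
  have weight: "(\<Prod>u\<in>V' - R'. P' u (g' u)) = (\<Sum>g\<in>?Fib g'. \<Prod>u\<in>V - R. P u (g u))"
    if g': "g' \<in> forests V' R'" for g'
  proof -
    have "(\<Prod>u\<in>V' - R'. P' u (g' u)) = (\<Prod>u\<in>V - R. P' (\<mu> u) (g' (\<mu> u)))"
      using prod.reindex_bij_betw[OF bij, of "\<lambda>u. P' u (g' u)"] by simp
    also have "\<dots> = (\<Prod>u\<in>V - R. \<Sum>t\<in>?B g' u. P u t)"
    proof (rule prod.cong[OF refl])
      fix u assume u: "u \<in> V - R"
      then have "\<mu> u \<in> V' - R'" using bij by (auto simp: bij_betw_def)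
      then have "g' (\<mu> u) \<in> V'" using forestsD(2)[OF g'] by auto
      with P[OF u] show "P' (\<mu> u) (g' (\<mu> u)) = (\<Sum>t\<in>?B g' u. P u t)" by simp
    qed
    also have "\<dots> = (\<Sum>g\<in>?Fib g'. \<Prod>u\<in>V - R. P u (g u))"
      using fin by (intro prod_sum_PiE) auto
    finally show ?thesis .
  qed
  have "(\<Sum>g'\<in>forests V' R'. (\<Prod>u\<in>V' - R'. P' u (g' u)) * \<Phi>' g') =
    (\<Sum>g'\<in>forests V' R'. \<Sum>g\<in>?Fib g'. (\<Prod>u\<in>V - R. P u (g u)) * \<Phi> g)"
  proof (rule sum.cong[OF refl])
    fix g' assume g': "g' \<in> forests V' R'"
    have "(\<Prod>u\<in>V' - R'. P' u (g' u)) * \<Phi>' g' = (\<Sum>g\<in>?Fib g'. (\<Prod>u\<in>V - R. P u (g u)) * \<Phi>' g')"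
      by (simp add: weight[OF g'] sum_distrib_right)
    also have "\<dots> = (\<Sum>g\<in>?Fib g'. (\<Prod>u\<in>V - R. P u (g u)) * \<Phi> g)"
    proof (rule sum.cong[OF refl])
      fix g assume g: "g \<in> ?Fib g'"
      then have "\<And>u. u \<in> V - R \<Longrightarrow> g' (\<mu> u) = \<mu> (g u)" unfolding fib_iff by blast
      from \<Phi>[OF fib_forest[OF g g'] g' this]
      show "(\<Prod>u\<in>V - R. P u (g u)) * \<Phi>' g' = (\<Prod>u\<in>V - R. P u (g u)) * \<Phi> g" by simp
    qed
    finally show "(\<Prod>u\<in>V' - R'. P' u (g' u)) * \<Phi>' g' = (\<Sum>g\<in>?Fib g'. (\<Prod>u\<in>V - R. P u (g u)) * \<Phi> g)" .
  qed
  also have "\<dots> = (\<Sum>(g', g)\<in>(SIGMA g':forests V' R'. ?Fib g'). (\<Prod>u\<in>V - R. P u (g u)) * \<Phi> g)"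
    using fin by (intro sum.Sigma) (auto simp: finite_forests intro!: finite_PiE)
  also have "\<dots> = (\<Sum>g\<in>forests V R. (\<Prod>u\<in>V - R. P u (g u)) * \<Phi> g)"
  proof -
    \<comment> \<open>Since \<mu> is invertible on non-roots, each \<open>g\<close> projects to
      exactly one forest \<open>?down g\<close>, so the sets of lifts partition the forests on
      \<open>V\<close>.\<close>
    define \<nu> where "\<nu> = the_inv_into (V - R) \<mu>"
    have \<nu>: "\<nu> (\<mu> u) = u" if "u \<in> V - R" for u
      using bij that by (auto simp: \<nu>_def bij_betw_def the_inv_into_f_f)
    have \<nu>': "\<nu> u' \<in> V - R" "\<mu> (\<nu> u') = u'" if "u' \<in> V' - R'" for u'
    proof -
      obtain u where "u \<in> V - R" "u' = \<mu> u" using bij \<open>u' \<in> V' - R'\<close> by (auto simp: bij_betw_def)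
      with \<nu>[of u] show "\<nu> u' \<in> V - R" "\<mu> (\<nu> u') = u'" by auto
    qed
    let ?down = "\<lambda>g. restrict (\<lambda>u'. \<mu> (g (\<nu> u'))) (V' - R')"
    have down_eq: "?down g (\<mu> u) = \<mu> (g u)" if "u \<in> V - R" for g u
      using that \<nu>[OF that] bij by (auto simp: bij_betw_def)
    show ?thesis
    proof (rule sum.reindex_bij_witness[of _ "\<lambda>g. (?down g, g)" snd], goal_cases)
      case (1 a)
      then obtain g g' where a: "a = (g', g)" "g' \<in> forests V' R'" "g \<in> ?Fib g'" by auto
      have "?down g u' = g' u'" for u'
      proof (cases "u' \<in> V' - R'")
        case True
        then show ?thesis using a(3) \<nu>'[OF True] unfolding fib_iff by (auto; metis)
      next
        case False
        then show ?thesis using forestsD(1)[OF a(2)] by (auto simp: PiE_iff extensional_def)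
      qed
      then have "?down g = g'" by (rule ext)
      then show ?case using a by simp
    next
      case (2 a)
      then show ?case using fib_forest by auto
    next
      case (4 g)
      have g_in: "\<And>u. u \<in> V - R \<Longrightarrow> g u \<in> V" using forestsD(2)[OF 4] by auto
      have "?down g \<in> (V' - R') \<rightarrow>\<^sub>E V'"
        using \<nu>' g_in maps by (auto simp: PiE_iff)
      moreover have "\<exists>r. leads (?down g) R' v' r" if v': "v' \<in> V'" for v'
      proof (cases "v' \<in> R'")
        case True
        then show ?thesis by (auto intro: leads.root)
      next
        case False
        with v' have v: "\<nu> v' \<in> V" "\<mu> (\<nu> v') = v'" using \<nu>'[of v'] by auto
        obtain r where "leads g R (\<nu> v') r" using forestsD(3)[OF 4 v(1)] by blast
        from leads_transport[OF this v(1) maps(2) g_in down_eq] show ?thesis unfolding v(2) by blast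
      qed
      ultimately have "?down g \<in> forests V' R'" by (auto simp: forests_def)
      moreover have "g \<in> ?Fib (?down g)"
        unfolding fib_iff using forestsD(1)[OF 4] down_eq by blast
      ultimately show ?case by simp
    qed auto
  qed
  finally show ?thesis ..
qed

section \<open>Merging two vertices\<close>

text \<open>In a product weight the factor of \<open>x\<close> becomes the weight of the restored
  arc; in this form one vertex after another can be peeled off.\<close>

lemma forest_weighted_split:
  fixes \<Phi> :: "('a \<Rightarrow> 'a) \<Rightarrow> real"
  assumes "finite V" "x \<in> V - R" "R \<subseteq> V"
  shows "(\<Sum>f\<in>forests V R. (\<Prod>u\<in>V - R. P u (f u)) * \<Phi> f) =
    (\<Sum>g\<in>forests V (insert x R). (\<Prod>u\<in>V - insert x R. P u (g u)) *
      (\<Sum>s | s \<in> V \<and> (\<exists>r\<in>R. leads g (insert x R) s r). P x s * \<Phi> (g(x := s))))"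
proof -
  have prod: "(\<Prod>u\<in>V - R. P u ((g(x := s)) u)) = P x s * (\<Prod>u\<in>V - insert x R. P u (g u))" for g s
  proof -
    have "(\<Prod>u\<in>V - R. P u ((g(x := s)) u)) =
      P x s * (\<Prod>u\<in>(V - R) - {x}. P u ((g(x := s)) u))"
      using assms by (subst prod.remove[of _ x]) auto
    also have "(V - R) - {x} = V - insert x R" by auto
    also have "(\<Prod>u\<in>V - insert x R. P u ((g(x := s)) u)) = (\<Prod>u\<in>V - insert x R. P u (g u))"
      by (rule prod.cong) auto
    finally show ?thesis .
  qed
  show ?thesis
    by (simp only: sum_forests_split[OF assms] prod sum_distrib_left mult_ac)
qed

text \<open>Two roots have no outgoing arcs, so identifying them creates no cycle and merely adds
  their columns. \<Phi> may depend on which vertices drain into the old roots \<open>R\<close>, as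
  this survives the merge; \<open>y\<close> is treated apart because it is no vertex of the merged
  digraph.\<close>

lemma sum_forests_merge:
  fixes \<Phi> \<Phi>' :: "('a \<Rightarrow> 'a) \<Rightarrow> real"
  assumes V: "finite V" "x \<in> V - R" "y \<in> V - R" "x \<noteq> y"
    and cols: "\<And>u s. u \<in> V - R - {x, y} \<Longrightarrow> s \<in> V - {x, y} \<Longrightarrow> P' u s = P u s"
      "\<And>u. u \<in> V - R - {x, y} \<Longrightarrow> P' u x = P u x + P u y"
    and \<Phi>: "\<And>g g'. g \<in> forests V (insert y (insert x R)) \<Longrightarrow> g' \<in> forests (V - {y}) (insert x R) \<Longrightarrow>
      (\<And>v r. v \<in> V \<Longrightarrow> r \<in> R \<Longrightarrow>
        leads g (insert y (insert x R)) v r \<longleftrightarrow> v \<noteq> y \<and> leads g' (insert x R) v r) \<Longrightarrow>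
      \<Phi> g = \<Phi>' g'"
  shows "(\<Sum>g\<in>forests V (insert y (insert x R)).
      (\<Prod>u\<in>V - insert y (insert x R). P u (g u)) * \<Phi> g) =
    (\<Sum>g'\<in>forests (V - {y}) (insert x R). (\<Prod>u\<in>(V - {y}) - insert x R. P' u (g' u)) * \<Phi>' g')"
proof -
  let ?\<mu> = "id(y := x)"
  have VR: "V - insert y (insert x R) = V - {y} - insert x R" by auto
  show ?thesis
  proof (rule sum_forests_transport[where \<mu> = ?\<mu>])
    show "bij_betw ?\<mu> (V - insert y (insert x R)) (V - {y} - insert x R)"
      unfolding VR by (rule bij_betwI[where g = id]) auto
  next
    fix u s' assume u: "u \<in> V - insert y (insert x R)" and s': "s' \<in> V - {y}"
    \<comment> \<open>Only \<open>x\<close> has two preimages, hence only its column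
      changes.\<close>
    have "{t. t \<in> V \<and> ?\<mu> t = s'} = (if s' = x then {x, y} else {s'})"
      using s' V by auto
    then show "P' (?\<mu> u) s' = (\<Sum>t | t \<in> V \<and> ?\<mu> t = s'. P u t)"
      using cols[of u] u s' V(4) by auto
  next
    fix g g'
    assume g: "g \<in> forests V (insert y (insert x R))" and g': "g' \<in> forests (V - {y}) (insert x R)"
      and eq: "\<And>u. u \<in> V - insert y (insert x R) \<Longrightarrow> g' (?\<mu> u) = ?\<mu> (g u)"
    have gV: "\<And>u. u \<in> V - insert y (insert x R) \<Longrightarrow> g u \<in> V"
      using forestsD(2)[OF g] by auto
    have iff: "\<And>u. u \<in> V \<Longrightarrow> u \<in> insert y (insert x R) \<longleftrightarrow> ?\<mu> u \<in> insert x R"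
      by auto
    show "\<Phi> g = \<Phi>' g'"
    proof (rule \<Phi>[OF g g'])
      fix v r assume v: "v \<in> V" and r: "r \<in> R"
      have ry: "r \<noteq> y" "r \<noteq> x" using r V by auto
      show "leads g (insert y (insert x R)) v r \<longleftrightarrow> v \<noteq> y \<and> leads g' (insert x R) v r"
      proof
        assume l: "leads g (insert y (insert x R)) v r"
        then have vy: "v \<noteq> y" using ry by (auto simp: leads_root_iff)
        with leads_transport[OF l v iff gV eq] ry show "v \<noteq> y \<and> leads g' (insert x R) v r"
          by simp
      next
        assume l: "v \<noteq> y \<and> leads g' (insert x R) v r"
        then obtain r0 where "leads g (insert y (insert x R)) v r0" "?\<mu> r0 = r"
          using leads_transport_back[OF conjunct2[OF l] _ v iff gV eq] by auto
        then show "leads g (insert y (insert x R)) v r" using ry by (auto split: if_splits)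
      qed
    qed
  qed (use V in auto)
qed

text \<open>For a forest \<open>g\<close> with \<open>x\<close> and \<open>y\<close> as extra roots,
  \<open>?S g R\<close>, \<open>?S g {x}\<close> and \<open>?S g {y}\<close> are the sets
  \<open>R\<close>, \<open>X\<close>, \<open>Y\<close> of the introduction. The admissible pairs of
  arcs weigh \<open>p(R)\<close> times a constant, and \<open>p(R)\<close> is the weight of the
  admissible arcs out of the merged vertex.\<close>

lemma forest_sum_merge_nonroots:
  assumes V: "finite V" "x \<in> V - R" "y \<in> V - R" "x \<noteq> y" "R \<subseteq> V"
    and rows: "\<And>s. s \<in> V \<Longrightarrow> P y s = p s"
      "\<And>s. s \<in> V \<Longrightarrow> P x s = p s + (if s = y then \<epsilon> else 0)"
    and row': "\<And>s. s \<in> V - {x, y} \<Longrightarrow> P' x s = p s"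
    and cols: "\<And>u s. u \<in> V - R - {x, y} \<Longrightarrow> s \<in> V - {x, y} \<Longrightarrow> P' u s = P u s"
      "\<And>u. u \<in> V - R - {x, y} \<Longrightarrow> P' u x = P u x + P u y"
  shows "forest_sum V R P = ((\<Sum>s\<in>V. p s) + \<epsilon>) * forest_sum (V - {y}) R P'"
proof -
  let ?Rx = "insert x R"
  let ?R2 = "insert y ?Rx"
  let ?S = "\<lambda>g Q. {s. s \<in> V \<and> (\<exists>r\<in>Q. leads g ?R2 s r)}"
  let ?A = "\<lambda>h. \<Sum>s | s \<in> V \<and> (\<exists>r\<in>R. leads h ?Rx s r). P x s"
  \<comment> \<open>The arc out of \<open>x\<close> is peeled off first, so its admissible heads
    depend on the arc chosen for \<open>y\<close>.\<close>
  have "forest_sum V R P = (\<Sum>h\<in>forests V ?Rx. (\<Prod>u\<in>V - ?Rx. P u (h u)) * ?A h)"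
    unfolding forest_sum_def using forest_weighted_split[OF V(1,2,5), of P "\<lambda>_. 1"] by simp
  also have "\<dots> = (\<Sum>g\<in>forests V ?R2. (\<Prod>u\<in>V - ?R2. P u (g u)) *
      (\<Sum>t\<in>?S g ?Rx. P y t * ?A (g(y := t))))"
    using V by (intro forest_weighted_split) auto
  also have "\<dots> = (\<Sum>g\<in>forests V ?R2. (\<Prod>u\<in>V - ?R2. P u (g u)) *
      (((\<Sum>s\<in>V. p s) + \<epsilon>) * (\<Sum>s\<in>?S g R. p s)))"
  proof (intro sum.cong refl arg_cong2[where f = "(*)"])
    fix g assume g: "g \<in> forests V ?R2"
    have uniq: "r = r'" if "leads g ?R2 v r" "leads g ?R2 v r'" for v r r'
      using leads_unique that by metis
    have ex: "\<exists>r\<in>?R2. leads g ?R2 v r" if "v \<in> V" for v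
      using forestsD(3)[OF g that] leads_in_roots by metis
    have yy: "leads g ?R2 y y" by (rule leads.root) simp
    have xR: "x \<notin> R" "y \<notin> R" using V by auto
    have y_not: "\<not> leads g ?R2 y r" if "r \<noteq> y" for r
      using uniq[OF yy] that by blast
    have disj: "?S g R \<inter> ?S g {x} = {}" "?S g R \<inter> ?S g {y} = {}" "(?S g R \<union> ?S g {x}) \<inter> ?S g {y} = {}"
      using uniq xR V(4) by blast+
    have fin: "finite (?S g Q)" for Q using V(1) by auto
    have cover: "V = (?S g R \<union> ?S g {x}) \<union> ?S g {y}"
      using ex by blast
    have z: "(\<Sum>s\<in>V. p s) = sum p (?S g R) + sum p (?S g {x}) + sum p (?S g {y})"
      by (subst cover) (simp only: sum.union_disjoint[OF finite_UnI[OF fin fin] fin disj(3)]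
        sum.union_disjoint[OF fin fin disj(1)])
    have upd: "g(y := t) \<in> forests V ?Rx" if "t \<in> ?S g ?Rx" for t
      using forests_upd_iff[of y V ?Rx t g, OF _ _ _ forestsD(1)[OF g]] that g V by auto
    \<comment> \<open>The component of \<open>y\<close> is available to \<open>x\<close> exactly
      when the head \<open>t\<close> of the arc out of \<open>y\<close> drains into
      \<open>R\<close>. If \<open>t\<close> drains into \<open>x\<close>, an arc from
      \<open>x\<close> into that component would close a cycle.\<close>
    have A_iff: "{s. s \<in> V \<and> (\<exists>r\<in>R. leads (g(y := t)) ?Rx s r)} =
      ?S g R \<union> (if \<exists>r\<in>R. leads g ?R2 t r then ?S g {y} else {})" if t: "t \<in> ?S g ?Rx" for t
    proof -
      have "leads (g(y := t)) ?Rx s r \<longleftrightarrow> leads g ?R2 s r \<or> leads g ?R2 s y \<and> leads g ?R2 t r"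
        if "s \<in> V" "r \<in> R" for s r
        using leads_upd_iff[OF _ upd[OF t], of s r] t that V by auto
      then show ?thesis by auto
    qed
    have "s \<noteq> y" if s: "s \<in> ?S g R" for s
    proof
      assume "s = y"
      with s obtain r where "r \<in> R" "leads g ?R2 y r" by blast
      with y_not[of r] xR show False by auto
    qed
    then have PxR: "sum (P x) (?S g R) = sum p (?S g R)"
      by (intro sum.cong) (auto simp: rows)
    \<comment> \<open>\<open>y\<close> lies in its own component, so \<epsilon> is picked up exactly
      once there.\<close>
    have "sum (P x) (?S g {y}) = P x y + sum (P x) (?S g {y} - {y})"
      using yy V fin by (intro sum.remove) auto
    also have "sum (P x) (?S g {y} - {y}) = sum p (?S g {y} - {y})"
      by (intro sum.cong) (auto simp: rows)
    also have "P x y + \<dots> = sum p (?S g {y}) + \<epsilon>"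
      using yy V fin by (subst (2) sum.remove[of _ y]) (auto simp: rows)
    finally have PxY: "sum (P x) (?S g {y}) = sum p (?S g {y}) + \<epsilon>" .
    have A_R: "?A (g(y := t)) = sum p (?S g R) + sum p (?S g {y}) + \<epsilon>" if t: "t \<in> ?S g R" for t
    proof -
      have "t \<in> ?S g ?Rx" "\<exists>r\<in>R. leads g ?R2 t r" using t by auto
      then have "?A (g(y := t)) = sum (P x) (?S g R \<union> ?S g {y})"
        by (simp only: A_iff if_True)
      also have "\<dots> = sum (P x) (?S g R) + sum (P x) (?S g {y})"
        by (rule sum.union_disjoint[OF fin fin disj(2)])
      finally show ?thesis by (simp only: PxR PxY add.assoc)
    qed
    have A_x: "?A (g(y := t)) = sum p (?S g R)" if t: "t \<in> ?S g {x}" for t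
    proof -
      have "t \<in> ?S g ?Rx" "\<not> (\<exists>r\<in>R. leads g ?R2 t r)" using t uniq xR by auto
      then have "?A (g(y := t)) = sum (P x) (?S g R)"
        by (simp only: A_iff if_False Un_empty_right)
      then show ?thesis by (simp add: PxR)
    qed
    have "?S g ?Rx = ?S g R \<union> ?S g {x}" by auto
    then have "(\<Sum>t\<in>?S g ?Rx. P y t * ?A (g(y := t))) =
      (\<Sum>t\<in>?S g R. P y t * ?A (g(y := t))) + (\<Sum>t\<in>?S g {x}. P y t * ?A (g(y := t)))"
      by (simp only: sum.union_disjoint[OF fin fin disj(1)])
    also have "(\<Sum>t\<in>?S g R. P y t * ?A (g(y := t))) =
      (\<Sum>t\<in>?S g R. p t * (sum p (?S g R) + sum p (?S g {y}) + \<epsilon>))"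
      by (rule sum.cong[OF refl]) (simp only: A_R, simp add: rows)
    also have "(\<Sum>t\<in>?S g {x}. P y t * ?A (g(y := t))) =
      (\<Sum>t\<in>?S g {x}. p t * sum p (?S g R))"
      by (rule sum.cong[OF refl]) (simp only: A_x, simp add: rows)
    finally show "(\<Sum>t\<in>?S g ?Rx. P y t * ?A (g(y := t))) =
        ((\<Sum>s\<in>V. p s) + \<epsilon>) * (\<Sum>s\<in>?S g R. p s)"
      unfolding z by (simp only: sum_distrib_right[symmetric]) (simp add: algebra_simps)
  qed
  also have "\<dots> = ((\<Sum>s\<in>V. p s) + \<epsilon>) * (\<Sum>g\<in>forests V ?R2. (\<Prod>u\<in>V - ?R2. P u (g u)) * (\<Sum>s\<in>?S g R. p s))"
    by (simp only: sum_distrib_left mult_ac)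
  also have "(\<Sum>g\<in>forests V ?R2. (\<Prod>u\<in>V - ?R2. P u (g u)) * (\<Sum>s\<in>?S g R. p s)) =
    (\<Sum>g'\<in>forests (V - {y}) ?Rx. (\<Prod>u\<in>(V - {y}) - ?Rx. P' u (g' u)) *
      (\<Sum>s | s \<in> V - {y} \<and> (\<exists>r\<in>R. leads g' ?Rx s r). P' x s))"
  proof (rule sum_forests_merge[OF V(1-4)])
    fix g g' assume *: "\<And>v r. v \<in> V \<Longrightarrow> r \<in> R \<Longrightarrow> leads g ?R2 v r \<longleftrightarrow> v \<noteq> y \<and> leads g' ?Rx v r"
    \<comment> \<open>A vertex draining into \<open>R\<close> is neither \<open>x\<close> nor
      \<open>y\<close>, and at such vertices the row of the merged vertex is
      \<open>p\<close>.\<close>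
    have "s \<noteq> x" if "leads g' ?Rx s r" "r \<in> R" for s r
      using that V by (auto simp: leads_root_iff)
    then show "(\<Sum>s\<in>?S g R. p s) = (\<Sum>s | s \<in> V - {y} \<and> (\<exists>r\<in>R. leads g' ?Rx s r). P' x s)"
      by (intro sum.cong) (auto simp: * row')
  qed (use cols in auto)
  also have "\<dots> = forest_sum (V - {y}) R P'"
  proof -
    have "R \<subseteq> V - {y}" "x \<in> V - {y} - R" using V by auto
    then show ?thesis
      unfolding forest_sum_def
      using forest_weighted_split[of "V - {y}" x R P' "\<lambda>_. 1"] V(1) by simp
  qed
  finally show ?thesis .
qed

section \<open>Redirecting last arcs, and merging a vertex into the root\<close>

lemma leads_via_last:
  assumes "\<And>u. u \<in> V - R \<Longrightarrow> g u \<in> V" "v \<in> V - R"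
  defines "C \<equiv> {u \<in> V - R. g u \<in> R}"
  shows "leads g R v r \<longleftrightarrow> (\<exists>u. leads g C v u \<and> g u = r)"
proof
  show "\<exists>u. leads g C v u \<and> g u = r" if "leads g R v r"
    using that assms(2)
  proof (induction rule: leads.induct)
    case (step v r)
    \<comment> \<open>\<open>C\<close> consists of the non-roots whose arc enters \<open>R\<close>,
      so the walk first meets \<open>C\<close> one step before it reaches \<open>R\<close>.\<close>
    show ?case
    proof (cases "g v \<in> R")
      case True
      with step have "r = g v" "v \<in> C" by (auto simp: leads_root_iff C_def)
      then show ?thesis by (auto intro: leads.root)
    next
      case False
      with step assms(1) have "\<exists>u. leads g C (g v) u \<and> g u = r" "v \<notin> C" by (auto simp: C_def)
      then show ?thesis by (auto intro: leads.step)
    qed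
  qed simp
  have "leads g R v (g u)" if "leads g C v u" for u
    using that assms(2)
  proof (induction rule: leads.induct)
    case (root v)
    then show ?case by (auto simp: C_def leads_step_iff leads_root_iff)
  next
    case (step v r)
    then have "g v \<in> V - R" using assms(1) by (auto simp: C_def)
    with step show ?case by (auto intro: leads.step)
  qed
  then show "leads g R v r" if "\<exists>u. leads g C v u \<and> g u = r" using that by blast
qed

text \<open>Redirecting the last arc on the walk from \<open>s\<close> to the roots swaps the two roots.\<close>

lemma forest_sum_toggle:
  assumes V: "finite V" "x \<in> V" "y \<in> V" "x \<noteq> y" "s \<in> V - {x, y}"
    and ratio: "\<And>u. u \<in> V - {x, y} \<Longrightarrow> P u x * wy = P u y * (wx::real)"
  shows "wy * (\<Sum>g | g \<in> forests V {x, y} \<and> leads g {x, y} s x. \<Prod>u\<in>V - {x, y}. P u (g u)) =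
    wx * (\<Sum>g | g \<in> forests V {x, y} \<and> leads g {x, y} s y. \<Prod>u\<in>V - {x, y}. P u (g u))"
proof -
  let ?R = "{x, y}"
  \<comment> \<open>\<open>l g\<close> is the last non-root on the walk from \<open>s\<close>, and
    \<tau> redirects its arc to the other root.\<close>
  define C where "C g = {u \<in> V - ?R. g u \<in> ?R}" for g
  define l where "l g = (THE u. leads g (C g) s u)" for g
  define sw where "sw v = (if v = x then y else x)" for v
  define \<tau> where "\<tau> g = g(l g := sw (g (l g)))" for g
  have l: "leads g (C g) s (l g)" "l g \<in> V - ?R" "leads g ?R s (g (l g))" "g (l g) \<in> ?R"
    if g: "g \<in> forests V ?R" for g
  proof -
    have gV: "\<And>u. u \<in> V - ?R \<Longrightarrow> g u \<in> V" using forestsD(2)[OF g] by auto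
    obtain r where "leads g ?R s r" using forestsD(3)[OF g] V(5) by blast
    then obtain u where u: "leads g (C g) s u"
      using leads_via_last[of V ?R g, OF gV V(5)] unfolding C_def by blast
    have "l g = u" unfolding l_def using u leads_unique[OF u] by blast
    with u leads_in_roots[OF u] show "leads g (C g) s (l g)" "l g \<in> V - ?R" "g (l g) \<in> ?R"
      by (auto simp: C_def)
    then show "leads g ?R s (g (l g))"
      using leads_via_last[of V ?R g, OF gV V(5)] unfolding C_def by blast
  qed
  have \<tau>: "\<tau> g \<in> forests V ?R" "l (\<tau> g) = l g" "\<tau> g (l g) = sw (g (l g))"
    if g: "g \<in> forests V ?R" for g
  proof -
    have lV: "l g \<in> V - ?R" "g (l g) \<in> ?R" using l[OF g] by auto
    have lC: "l g \<in> C g" using lV by (auto simp: C_def)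
    \<comment> \<open>The redirected arc still ends in a root, so the walk from \<open>s\<close> to
      \<open>l g\<close> is unchanged; this makes \<tau> an involution.\<close>
    have C_eq: "C (\<tau> g) = C g" using lV by (auto simp: C_def \<tau>_def sw_def)
    have leads_eq: "leads (\<tau> g) (C g) v u" if "leads g (C g) v u" for v u
      using that by (rule leads_cong) (use lC in \<open>auto simp: \<tau>_def\<close>)
    show "l (\<tau> g) = l g"
      using leads_eq[OF l(1)[OF g]] unfolding l_def[of "\<tau> g"] C_eq
      by (intro the_equality) (auto dest: leads_unique)
    have gV: "\<And>u. u \<in> V - ?R \<Longrightarrow> g u \<in> V" using forestsD(2)[OF g] by auto
    have \<tau>V: "\<And>u. u \<in> V - ?R \<Longrightarrow> \<tau> g u \<in> V" using gV V by (auto simp: \<tau>_def sw_def)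
    have "\<tau> g \<in> (V - ?R) \<rightarrow>\<^sub>E V"
      using \<tau>V forestsD(1)[OF g] lV by (auto simp: PiE_iff extensional_def \<tau>_def)
    moreover have "\<exists>r. leads (\<tau> g) ?R v r" if v: "v \<in> V" for v
    proof (cases "v \<in> ?R")
      case True
      then show ?thesis by (auto intro: leads.root)
    next
      case False
      obtain r where "leads g ?R v r" using forestsD(3)[OF g v] by blast
      then obtain u where "leads g (C g) v u"
        using leads_via_last[of V ?R g v, OF gV] False v unfolding C_def by blast
      then have "leads (\<tau> g) (C (\<tau> g)) v u" unfolding C_eq by (rule leads_eq)
      then show ?thesis
        using leads_via_last[of V ?R "\<tau> g" v, OF \<tau>V] False v unfolding C_def[of "\<tau> g"] by blast
    qed
    ultimately show "\<tau> g \<in> forests V ?R" by (auto simp: forests_def)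
    show "\<tau> g (l g) = sw (g (l g))" by (simp add: \<tau>_def)
  qed
  have \<tau>\<tau>: "\<tau> (\<tau> g) = g" if g: "g \<in> forests V ?R" for g
    unfolding \<tau>_def[of "\<tau> g"] \<tau>(2)[OF g] \<tau>(3)[OF g]
    using l(4)[OF g] by (auto simp: \<tau>_def sw_def fun_upd_idem_iff)
  have leads_iff: "leads g ?R s r \<longleftrightarrow> g (l g) = r" if "g \<in> forests V ?R" for g r
    using l(3)[OF that] leads_unique by metis
  have weight: "wy * (\<Prod>u\<in>V - ?R. P u (g u)) = wx * (\<Prod>u\<in>V - ?R. P u (\<tau> g u))"
    if g: "g \<in> forests V ?R" and gx: "g (l g) = x" for g
  proof -
    have lV: "l g \<in> V - ?R" using l[OF g] by auto
    have "(\<Prod>u\<in>V - ?R. P u (g u)) = P (l g) x * (\<Prod>u\<in>V - ?R - {l g}. P u (g u))"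
      using V(1) lV gx by (subst prod.remove[of _ "l g"]) auto
    moreover have "(\<Prod>u\<in>V - ?R. P u (\<tau> g u)) = P (l g) y * (\<Prod>u\<in>V - ?R - {l g}. P u (\<tau> g u))"
      using V(1) lV gx by (subst prod.remove[of _ "l g"]) (auto simp: \<tau>_def sw_def)
    moreover have "(\<Prod>u\<in>V - ?R - {l g}. P u (\<tau> g u)) = (\<Prod>u\<in>V - ?R - {l g}. P u (g u))"
      by (rule prod.cong) (auto simp: \<tau>_def)
    ultimately show ?thesis using ratio[OF lV] by (simp add: mult_ac)
  qed
  have "(\<Sum>g | g \<in> forests V ?R \<and> leads g ?R s x. wy * (\<Prod>u\<in>V - ?R. P u (g u))) =
    (\<Sum>g | g \<in> forests V ?R \<and> leads g ?R s y. wx * (\<Prod>u\<in>V - ?R. P u (g u)))"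
    by (rule sum.reindex_bij_witness[of _ \<tau> \<tau>])
      (use \<tau> \<tau>\<tau> leads_iff weight V(4) in \<open>auto simp: sw_def\<close>)
  then show ?thesis by (simp add: sum_distrib_left)
qed

text \<open>Only the arc of \<open>q\<close> has to be restored, and its head must drain into
  \<open>r\<close>. Each other vertex \<open>s\<close> drains into \<open>r\<close> in a share
  \<open>wr / (wr + wq)\<close> of the total forest weight, while the arc of weight \<epsilon> to
  \<open>r\<close> itself is always admissible.\<close>

lemma forest_sum_merge_root:
  assumes V: "finite V" "r \<in> V" "q \<in> V" "r \<noteq> q"
    and row: "\<And>s. s \<in> V \<Longrightarrow> P q s = p s + (if s = r then \<epsilon> else 0)" "p r = 0" "p q = 0"
    and cols: "\<And>u s. u \<in> V - {r, q} \<Longrightarrow> s \<in> V - {r, q} \<Longrightarrow> P' u s = P u s"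
      "\<And>u. u \<in> V - {r, q} \<Longrightarrow> P' u r = P u r + P u q"
    and ratio: "\<And>u. u \<in> V - {r, q} \<Longrightarrow> P u r * wq = P u q * wr"
  shows "(wr + wq) * forest_sum V {r} P =
    (wr * (\<Sum>s\<in>V. p s) + \<epsilon> * (wr + wq)) * forest_sum (V - {q}) {r} P'"
proof -
  let ?R = "{q, r}"
  let ?wt = "\<lambda>g. \<Prod>u\<in>V - ?R. P u (g u)"
  let ?F = "forest_sum (V - {q}) {r} P'"
  have merged: "(\<Sum>g\<in>forests V ?R. ?wt g) = ?F"
    using sum_forests_merge[of V r "{}" q P' P "\<lambda>_. 1" "\<lambda>_. 1"] V cols by (auto simp: forest_sum_def)
  have rq: "{r, q} = ?R" by auto
  have share: "(wr + wq) * (\<Sum>g | g \<in> forests V ?R \<and> leads g ?R s r. ?wt g) = wr * ?F"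
    if s: "s \<in> V - ?R" for s
  proof -
    let ?S = "\<lambda>x. {g \<in> forests V ?R. leads g ?R s x}"
    have fin: "finite (?S x)" for x using finite_forests[OF V(1)] by auto
    have "?S r \<inter> ?S q = {}" using V(4) leads_unique by fastforce
    moreover have "forests V ?R = ?S r \<union> ?S q"
    proof -
      have "leads g ?R s r \<or> leads g ?R s q" if "g \<in> forests V ?R" for g
        using forestsD(3)[OF that, of s] s leads_in_roots[of g ?R s] by auto
      then show ?thesis by auto
    qed
    ultimately have "?F = sum ?wt (?S r) + sum ?wt (?S q)"
      unfolding merged[symmetric] using sum.union_disjoint[OF fin[of r] fin[of q], of ?wt] by simp
    moreover have "wq * sum ?wt (?S r) = wr * sum ?wt (?S q)"
      using forest_sum_toggle[of V r q s P wq wr] V s ratio unfolding rq by auto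
    ultimately show ?thesis by (simp add: algebra_simps)
  qed
  have "forest_sum V {r} P = (\<Sum>g\<in>forests V ?R. ?wt g * (\<Sum>s | s \<in> V \<and> leads g ?R s r. P q s))"
    unfolding forest_sum_def
    using forest_weighted_split[of V q "{r}" P "\<lambda>_. 1"] V by simp
  also have "\<dots> = (\<Sum>g\<in>forests V ?R. ?wt g * ((\<Sum>s\<in>V - ?R. if leads g ?R s r then p s else 0) + \<epsilon>))"
  proof (intro sum.cong refl arg_cong2[where f = "(*)"])
    fix g
    let ?S = "{s. s \<in> V \<and> leads g ?R s r}"
    have qr: "\<not> leads g ?R q r" "leads g ?R r r" using V by (auto simp: leads_root_iff)
    have "sum (P q) ?S = P q r + sum (P q) (?S - {r})"
      using V qr by (intro sum.remove) auto
    also have "sum (P q) (?S - {r}) = (\<Sum>s\<in>?S - {r}. p s)"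
      by (intro sum.cong) (auto simp: row)
    also have "?S - {r} = (V - ?R) \<inter> {s. leads g ?R s r}" using qr by auto
    also have "sum p \<dots> = (\<Sum>s\<in>V - ?R. if leads g ?R s r then p s else 0)"
      using V by (subst sum.inter_restrict) auto
    finally show "sum (P q) ?S = (\<Sum>s\<in>V - ?R. if leads g ?R s r then p s else 0) + \<epsilon>"
      using V by (simp add: row)
  qed
  also have "\<dots> = (\<Sum>g\<in>forests V ?R. \<Sum>s\<in>V - ?R. p s * (if leads g ?R s r then ?wt g else 0)) + \<epsilon> * ?F"
    unfolding merged[symmetric]
    by (simp add: distrib_left sum.distrib sum_distrib_left sum_distrib_right mult_ac if_distrib cong: if_cong)
  also have "(\<Sum>g\<in>forests V ?R. \<Sum>s\<in>V - ?R. p s * (if leads g ?R s r then ?wt g else 0)) =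
    (\<Sum>s\<in>V - ?R. p s * (\<Sum>g | g \<in> forests V ?R \<and> leads g ?R s r. ?wt g))"
    by (subst sum.swap) (simp add: sum_distrib_left[symmetric] sum.inter_filter finite_forests V(1))
  finally have "(wr + wq) * forest_sum V {r} P =
    (\<Sum>s\<in>V - ?R. p s * ((wr + wq) * (\<Sum>g | g \<in> forests V ?R \<and> leads g ?R s r. ?wt g))) + (wr + wq) * (\<epsilon> * ?F)"
    by (simp only: distrib_left sum_distrib_left mult_ac)
  also have "(\<Sum>s\<in>V - ?R. p s * ((wr + wq) * (\<Sum>g | g \<in> forests V ?R \<and> leads g ?R s r. ?wt g))) =
    (\<Sum>s\<in>V - ?R. p s * (wr * ?F))"
    by (intro sum.cong refl) (simp only: share)
  also have "\<dots> = (\<Sum>s\<in>V - ?R. p s) * (wr * ?F)"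
    by (simp only: sum_distrib_right)
  also have "(\<Sum>s\<in>V - ?R. p s) = (\<Sum>s\<in>V. p s)"
    using V row by (intro sum.mono_neutral_left) auto
  finally show ?thesis by (simp add: algebra_simps)
qed

section \<open>Oriented spanning trees as functions\<close>

text \<open>The number of steps to the root set drops by one along every arc; such a rank later
  rules out cycles of the underlying graph.\<close>

lemma leads_rank:
  fixes f :: "'a \<Rightarrow> 'a"
  assumes "\<And>v. v \<in> V \<Longrightarrow> \<exists>r. leads f R v r"
  obtains d :: "'a \<Rightarrow> nat" where "\<And>v. v \<in> V - R \<Longrightarrow> d (f v) < d v"
proof
  define d where "d v = (LEAST n. (f ^^ n) v \<in> R)" for v
  show "d (f v) < d v" if v: "v \<in> V - R" for v
  proof -
    have reach: "\<exists>n. (f ^^ n) u \<in> R" if "leads f R u r" for u r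
      using that
    proof (induction rule: leads.induct)
      case (root v)
      then show ?case by (intro exI[of _ 0]) simp
    next
      case (step v r)
      then obtain n where "(f ^^ n) (f v) \<in> R" by blast
      then show ?case by (intro exI[of _ "Suc n"]) (simp add: funpow_swap1)
    qed
    obtain n where "(f ^^ n) v \<in> R" using assms[of v] reach v by auto
    then have dv: "(f ^^ d v) v \<in> R" unfolding d_def by (rule LeastI)
    with v obtain m where m: "d v = Suc m" by (cases "d v") auto
    with dv have "(f ^^ m) (f v) \<in> R" by (simp add: funpow_swap1)
    then have "d (f v) \<le> m" unfolding d_def by (rule Least_le)
    with m show ?thesis by simp
  qed
qed

section \<open>Cycles as lists of arcs\<close>

lemma pcas_arcs_consecutive:
  assumes "pcas u p w" "i < length p"
  shows "fst (p ! i) = (if i = 0 then u else snd (p ! (i - 1)))"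
    "i = length p - 1 \<Longrightarrow> snd (p ! i) = w"
proof -
  have "fst (p ! i) = (if i = 0 then u else snd (p ! (i - 1))) \<and>
    (i = length p - 1 \<longrightarrow> snd (p ! i) = w)"
    using assms
  proof (induction p arbitrary: u i)
    case (Cons e es)
    show ?case
    proof (cases i)
      case 0
      with Cons.prems show ?thesis by (cases es) auto
    next
      case (Suc j)
      with Cons.prems have "pcas (snd e) es w" "j < length es" by auto
      note IH = Cons.IH[OF this]
      have "fst (es ! j) = snd ((e # es) ! j)" using IH by (cases j) auto
      moreover have "snd (es ! j) = w" if "i = length (e # es) - 1"
      proof -
        have "j = length es - 1" using that Suc by simp
        with IH show ?thesis by blast
      qed
      moreover have eqs: "(e # es) ! i = es ! j" "i - 1 = j" and "i \<noteq> 0" using Suc by auto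
      ultimately show ?thesis unfolding eqs by simp
    qed
  qed simp
  then show "fst (p ! i) = (if i = 0 then u else snd (p ! (i - 1)))"
    "i = length p - 1 \<Longrightarrow> snd (p ! i) = w" by auto
qed

lemma pawalk_verts_tl: "tl (pawalk_verts u p) = map snd p" if "pcas u p w"
proof -
  have "pawalk_verts u p = u # map snd p" if "pcas u p w" for u
    using that by (induction p arbitrary: u) auto
  with that show ?thesis by simp
qed

text \<open>The tail of the vertex list is the list of heads of the arcs. In this form a cycle
  passes easily to the symmetric closure.\<close>

lemma cycle_with_proj_iff:
  "pre_digraph.cycle (with_proj G) c \<longleftrightarrow>
    (\<exists>u\<in>pverts G. set c \<subseteq> parcs G \<and> pcas u c u \<and> distinct (map snd c) \<and> c \<noteq> [])"
  unfolding pre_digraph.cycle_def pre_digraph.awalk_def cas_with_proj_eq awalk_verts_with_proj_eq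
    with_proj_simps
  using pawalk_verts_tl by metis

lemma pair_digraphD:
  assumes "pair_digraph D"
  shows "finite (pverts D)" "finite (parcs D)" "pair_wf_digraph D" "(x, x) \<notin> parcs D"
  using assms pair_loopfree_digraph.pair_no_loops[of D "(x, x)"]
  by (auto simp: pair_digraph_def pair_fin_digraph_def pair_fin_digraph_axioms_def)

lemma ex_maximal_index:
  fixes e :: "nat \<Rightarrow> nat"
  shows "0 < k \<Longrightarrow> \<exists>i<k. \<forall>l<k. e l \<le> e i"
proof (induction k)
  case (Suc k)
  show ?case
  proof (cases "k = 0")
    case False
    with Suc.IH obtain i where i: "i < k" "\<forall>l<k. e l \<le> e i" by blast
    show ?thesis
    proof (cases "e k \<le> e i")
      case True
      with i have "i < Suc k" "\<forall>l<Suc k. e l \<le> e i" by (simp_all add: less_Suc_eq)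
      then show ?thesis by blast
    next
      case False
      have "e l \<le> e k" if "l < Suc k" for l
      proof (cases "l = k")
        case False
        with that have "e l \<le> e i" using i(2) by simp
        with \<open>\<not> e k \<le> e i\<close> show ?thesis by linarith
      qed simp
      then show ?thesis by blast
    qed
  qed simp
qed simp

text \<open>At a vertex of maximal rank on the cycle, both incident arcs leave it.\<close>

lemma no_long_cycle_of_rank:
  fixes d :: "'a \<Rightarrow> nat"
  assumes rank: "\<And>v w. (v, w) \<in> A \<Longrightarrow> d w < d v"
    and sv: "single_valued A"
    and cyc: "pcas u p u" "distinct (map snd p)" "set p \<subseteq> A \<union> A\<inverse>" "3 \<le> length p"
  shows False
proof -
  define k where "k = length p"
  have k: "3 \<le> k" using cyc(4) by (simp add: k_def)
  define vv where "vv i = snd (p ! i)" for i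
  obtain i where ik: "i < k" and max: "\<And>l. l < k \<Longrightarrow> d (vv l) \<le> d (vv i)"
  proof -
    have "0 < k" using k by simp
    from ex_maximal_index[OF this, of "\<lambda>i. d (vv i)"] that show thesis by blast
  qed
  \<comment> \<open>\<open>h\<close> and \<open>j\<close> are the cyclic predecessor and successor
    of the index \<open>i\<close> of maximal rank; they differ because the length is at least
    3.\<close>
  define h where "h = (if i = 0 then k - 1 else i - 1)"
  define j where "j = (if i = k - 1 then 0 else i + 1)"
  have h: "h < k" unfolding h_def using ik k by (cases "i = 0"; simp)
  have j: "j < k" unfolding j_def using ik k by (cases "i = k - 1"; simp)
  have hj: "h \<noteq> j" unfolding h_def j_def using ik k by (cases "i = 0"; cases "i = k - 1"; simp)
  have last: "snd (p ! (k - 1)) = u"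
    using pcas_arcs_consecutive(2)[OF cyc(1), of "k - 1"] k unfolding k_def by simp
  have "fst (p ! i) = vv h"
    using pcas_arcs_consecutive(1)[OF cyc(1), of i] ik last unfolding h_def vv_def k_def by simp
  then have arc_i: "p ! i = (vv h, vv i)" by (simp add: prod_eq_iff vv_def)
  have "fst (p ! j) = vv i"
    using pcas_arcs_consecutive(1)[OF cyc(1), of j] j last unfolding j_def vv_def k_def
    by (cases "i = length p - 1"; simp)
  then have arc_j: "p ! j = (vv i, vv j)" by (simp add: prod_eq_iff vv_def)
  \<comment> \<open>The neighbours of \<open>vv i\<close> are distinct, so two different arcs of
    \<open>A\<close> would leave \<open>vv i\<close>, against single-valuedness.\<close>
  have "vv h \<noteq> vv j"
    using nth_eq_iff_index_eq[OF cyc(2), of h j] h j hj by (simp add: vv_def k_def)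
  moreover have "(vv h, vv i) \<in> A \<union> A\<inverse>"
    using subsetD[OF cyc(3) nth_mem[of i p]] ik unfolding arc_i k_def .
  then have "(vv i, vv h) \<in> A"
    using rank[of "vv h" "vv i"] max[OF h] by (meson UnE converseD not_le)
  moreover have "(vv i, vv j) \<in> A \<union> A\<inverse>"
    using subsetD[OF cyc(3) nth_mem[of j p]] j unfolding arc_j k_def .
  then have "(vv i, vv j) \<in> A"
    using rank[of "vv j" "vv i"] max[OF j] by (meson UnE converseD not_le)
  ultimately show False using sv unfolding single_valued_def by blast
qed

section \<open>The correspondence between functions and oriented spanning trees\<close>

definition graph_of :: "'a set \<Rightarrow> 'a \<Rightarrow> ('a \<Rightarrow> 'a) \<Rightarrow> 'a pair_pre_digraph" where
  "graph_of V r f = \<lparr>pverts = V, parcs = (\<lambda>u. (u, f u)) ` (V - {r})\<rparr>"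

lemma graph_of_simps [simp]:
  "pverts (graph_of V r f) = V" "parcs (graph_of V r f) = (\<lambda>u. (u, f u)) ` (V - {r})"
  by (simp_all add: graph_of_def)

lemma out_arcs_graph_of:
  "out_arcs (with_proj (graph_of V r f)) u = (if u \<in> V - {r} then {(u, f u)} else {})"
  by (auto simp: out_arcs_def)

text \<open>Every vertex walks to \<open>r\<close>, which gives connectedness. The rank drops along
  arcs, which excludes both long cycles and opposite arcs.\<close>

lemma graph_of_oriented_spanning_tree:
  assumes D: "pair_digraph D" and r: "r \<in> pverts D"
    and f: "f \<in> forests (pverts D) {r}" "\<And>u. u \<in> pverts D - {r} \<Longrightarrow> (u, f u) \<in> parcs D"
  shows "graph_of (pverts D) r f \<in> oriented_spanning_trees D r"
proof -
  let ?V = "pverts D"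
  let ?T = "graph_of ?V r f"
  have fV: "\<And>u. u \<in> ?V \<Longrightarrow> u \<noteq> r \<Longrightarrow> f u \<in> ?V" using forestsD(2)[OF f(1)] by auto
  have "pair_wf_digraph ?T"
  proof
    fix e assume "e \<in> parcs ?T"
    then obtain u where u: "u \<in> ?V" "u \<noteq> r" "e = (u, f u)" by auto
    with fV[OF u(1,2)] show "fst e \<in> pverts ?T" "snd e \<in> pverts ?T" by auto
  qed
  then have wfT: "wf_digraph (with_proj ?T)" by (simp only: wf_digraph_wp_iff)
  have wfD: "wf_digraph (with_proj D)" using pair_digraphD(3)[OF D] by (simp only: wf_digraph_wp_iff)
  obtain d :: "'a \<Rightarrow> nat" where d: "\<And>v. v \<in> ?V - {r} \<Longrightarrow> d (f v) < d v"
    using leads_rank[of ?V f "{r}"] forestsD(3)[OF f(1)] by blast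
  have span: "spanning (with_proj ?T) (with_proj D)"
    using f(2) wfT wfD by (auto simp: spanning_def subgraph_def)
  have reach: "v \<rightarrow>\<^sup>*\<^bsub>with_proj ?T\<^esub> r" if "leads f {r} v r'" "v \<in> ?V" for v r'
    using that
  proof (induction rule: leads.induct)
    case (root v)
    then show ?case by (auto intro!: wf_digraph.reachable_refl[OF wfT])
  next
    case (step v r')
    have v: "v \<in> ?V" "v \<noteq> r" using step.hyps(1) step.prems by auto
    have "v \<rightarrow>\<^bsub>with_proj ?T\<^esub> f v" using v by simp
    moreover have "f v \<rightarrow>\<^sup>*\<^bsub>with_proj ?T\<^esub> r" by (rule step.IH[OF fV[OF v]])
    ultimately show ?case by (rule wf_digraph.adj_reachable_trans[OF wfT])
  qed
  have wfS: "wf_digraph (with_proj (mk_symmetric (with_proj ?T)))"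
    using wf_digraph.wellformed_mk_symmetric[OF wfT] by (simp only: wf_digraph_wp_iff)
  have conn: "connected (with_proj ?T)"
    unfolding connected_def
  proof (intro strongly_connectedI)
    fix u v assume "u \<in> verts (with_proj (mk_symmetric (with_proj ?T)))"
      "v \<in> verts (with_proj (mk_symmetric (with_proj ?T)))"
    then have uv: "u \<in> ?V" "v \<in> ?V" by auto
    have "u \<rightarrow>\<^sup>*\<^bsub>with_proj ?T\<^esub> r" "v \<rightarrow>\<^sup>*\<^bsub>with_proj ?T\<^esub> r"
      using reach uv forestsD(3)[OF f(1)] by blast+
    then have "u \<rightarrow>\<^sup>*\<^bsub>mk_symmetric (with_proj ?T)\<^esub> r" "v \<rightarrow>\<^sup>*\<^bsub>mk_symmetric (with_proj ?T)\<^esub> r"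
      by (auto intro: wf_digraph.reachable_mk_symmetricI[OF wfT])
    then show "u \<rightarrow>\<^sup>*\<^bsub>mk_symmetric (with_proj ?T)\<^esub> v"
      using symmetric_mk_symmetric symmetric_reachable wf_digraph.reachable_trans[OF wfS] by metis
  qed (use r in auto)
  have rank: "d w < d v" if "(v, w) \<in> parcs ?T" for v w
    using that d by auto
  have "\<not> (\<exists>c. pre_digraph.cycle (with_proj (mk_symmetric (with_proj ?T))) c \<and> 3 \<le> length c)"
  proof
    assume "\<exists>c. pre_digraph.cycle (with_proj (mk_symmetric (with_proj ?T))) c \<and> 3 \<le> length c"
    then obtain c u where "pcas u c u" "distinct (map snd c)"
      "set c \<subseteq> parcs (mk_symmetric (with_proj ?T))" "3 \<le> length c"
      unfolding cycle_with_proj_iff by blast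
    moreover have "parcs (mk_symmetric (with_proj ?T)) = parcs ?T \<union> (parcs ?T)\<inverse>"
      by (auto simp: parcs_mk_symmetric)
    moreover have "single_valued (parcs ?T)" by (auto simp: single_valued_def)
    ultimately show False using no_long_cycle_of_rank[of "parcs ?T" d u c] rank by simp
  qed
  moreover have "(w, u) \<notin> parcs ?T" if "(u, w) \<in> parcs ?T" for u w
    using rank[OF that] rank[of w u] by force
  ultimately have "underlying_tree ?T"
    unfolding underlying_tree_def using conn by blast
  then show ?thesis
    using span r by (auto simp: oriented_spanning_trees_def out_degree_def out_arcs_graph_of)
qed

text \<open>\<open>f\<close> sends each non-root to the head of its only outgoing arc; since the
  underlying graph has no cycles, every walk along \<open>f\<close> ends, and it can end only at
  \<open>r\<close>.\<close>

lemma oriented_spanning_treeE: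
  assumes D: "pair_digraph D" and r: "r \<in> pverts D" and T: "T \<in> oriented_spanning_trees D r"
  obtains f where "f \<in> forests (pverts D) {r}" "\<And>u. u \<in> pverts D - {r} \<Longrightarrow> (u, f u) \<in> parcs D"
    "T = graph_of (pverts D) r f"
proof -
  let ?V = "pverts D"
  have T_props: "pverts T = ?V" "parcs T \<subseteq> parcs D" "underlying_tree T"
    and out: "out_degree (with_proj T) r = 0"
      "\<And>u. u \<in> ?V - {r} \<Longrightarrow> out_degree (with_proj T) u = 1"
    and wfT: "wf_digraph (with_proj T)"
    using T by (auto simp: oriented_spanning_trees_def spanning_def subgraph_def)
  then have pwfT: "pair_wf_digraph T" by (simp only: wf_digraph_wp_iff)
  have finT: "finite (parcs T)" using T_props(2) pair_digraphD(2)[OF D] finite_subset by blast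
  define f where "f u = (if u \<in> ?V - {r} then THE w. (u, w) \<in> parcs T else undefined)" for u
  have out_f: "(u, w) \<in> parcs T \<longleftrightarrow> w = f u" if u: "u \<in> ?V - {r}" for u w
  proof -
    obtain e where e: "out_arcs (with_proj T) u = {e}"
      using out(2)[OF u] unfolding out_degree_def by (auto simp: card_1_singleton_iff)
    have mem: "x \<in> out_arcs (with_proj T) u \<longleftrightarrow> x \<in> parcs T \<and> fst x = u" for x
      by (simp add: out_arcs_def)
    have "(u, w) \<in> parcs T \<longleftrightarrow> (u, w) = e" for w
      using mem[of "(u, w)"] unfolding e by simp
    moreover have "fst e = u" using mem[of e] unfolding e by simp
    ultimately have *: "(u, w) \<in> parcs T \<longleftrightarrow> w = snd e" for w by (cases e) auto
    then have "f u = snd e" using u by (simp add: f_def)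
    with * show ?thesis by simp
  qed
  have no_r: "(r, w) \<notin> parcs T" for w
  proof -
    \<comment> \<open>The out-degree is a \<open>card\<close>, which is 0 for infinite sets too, so
      finiteness is required to conclude that no arc leaves \<open>r\<close>.\<close>
    have "finite (out_arcs (with_proj T) r)" using finT by (simp add: out_arcs_def)
    with out(1) show ?thesis by (auto simp: out_degree_def out_arcs_def)
  qed
  have parcs_T: "parcs T = (\<lambda>u. (u, f u)) ` (?V - {r})"
  proof (intro set_eqI iffI)
    fix e assume e: "e \<in> parcs T"
    obtain u w where [simp]: "e = (u, w)" by (cases e)
    have "u \<in> ?V - {r}" using e no_r pair_wf_digraph.in_arcsD1[OF pwfT, of u w] T_props by auto
    with e out_f show "e \<in> (\<lambda>u. (u, f u)) ` (?V - {r})" by auto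
  qed (use out_f in auto)
  then have T_eq: "T = graph_of ?V r f"
    using T_props(1) by (simp add: graph_of_def)
  have fV: "f u \<in> ?V" if "u \<in> ?V - {r}" for u
    using that out_f[OF that, of "f u"] pair_wf_digraph.in_arcsD2[OF pwfT, of u "f u"] T_props by auto
  \<comment> \<open>A directed cycle is also a cycle of the symmetric closure, where length 3 or
    more is excluded. One of length 2 consists of opposite arcs, and a loop is its own
    reverse.\<close>
  have "acyclic (parcs T)"
  proof (rule acyclicI, intro allI notI)
    fix x assume "(x, x) \<in> (parcs T)\<^sup>+"
    then obtain p where "pre_digraph.awalk (with_proj T) x p x" "p \<noteq> []"
      using wf_digraph.reachable1_awalk[OF wfT, of x x] by auto
    then have "wf_digraph.closed_w (with_proj T) p"
      unfolding wf_digraph.closed_w_def[OF wfT] by auto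
    then obtain c where "pre_digraph.cycle (with_proj T) c"
      using wf_digraph.closed_w_imp_cycle[OF wfT] by blast
    then obtain u where c: "u \<in> pverts T" "set c \<subseteq> parcs T" "pcas u c u" "distinct (map snd c)" "c \<noteq> []"
      unfolding cycle_with_proj_iff by blast
    have no2: "\<And>u w. (u, w) \<in> parcs T \<Longrightarrow> (w, u) \<notin> parcs T"
      and no3: "\<And>c. \<not> (pre_digraph.cycle (with_proj (mk_symmetric (with_proj T))) c \<and> 3 \<le> length c)"
      using T_props(3) unfolding underlying_tree_def by blast+
    have "set c \<subseteq> parcs (mk_symmetric (with_proj T))"
      using c(2) by (auto simp: parcs_mk_symmetric)
    with c have "pre_digraph.cycle (with_proj (mk_symmetric (with_proj T))) c"
      unfolding cycle_with_proj_iff by auto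
    with no3 have len: "length c < 3" by (metis not_le)
    note pc = c(2,3)
    show False
    proof (cases c)
      case (Cons e es)
      show False
      proof (cases es)
        case Nil
        with Cons pc show False using no2[of u u] by (cases e) auto
      next
        case (Cons e' es')
        with \<open>c = e # es\<close> len have "c = [e, e']" by auto
        with pc show False using no2 by (cases e; cases e') auto
      qed
    qed (use c in simp)
  qed
  then have wf: "wf ((parcs T)\<inverse>)" using finT by (rule finite_acyclic_wf_converse[rotated])
  have "\<exists>r'. leads f {r} v r'" if "v \<in> ?V" for v
    using wf that
  proof (induction v rule: wf_induct_rule)
    case (less v)
    show ?case
    proof (cases "v = r")
      case True
      then show ?thesis by (auto intro: leads.root)
    next
      case False
      with less.prems have v: "v \<in> ?V - {r}" by simp
      with out_f[OF v] less.IH[of "f v"] fV obtain r' where "leads f {r} (f v) r'" by auto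
      with False show ?thesis by (auto intro: leads.step)
    qed
  qed
  then have "f \<in> forests ?V {r}"
    using fV by (auto simp: forests_def PiE_iff extensional_def f_def)
  moreover have "(u, f u) \<in> parcs D" if "u \<in> ?V - {r}" for u
    using out_f[OF that] T_props(2) by auto
  ultimately show thesis using that T_eq by blast
qed

lemma graph_of_eq_imp:
  assumes "f \<in> forests V {r}" "g \<in> forests V {r}" "graph_of V r f = graph_of V r g"
  shows "f = g"
proof (rule PiE_ext[OF forestsD(1)[OF assms(1)] forestsD(1)[OF assms(2)]])
  fix u assume "u \<in> V - {r}"
  then have "(u, f u) \<in> parcs (graph_of V r f)" by simp
  then show "f u = g u" unfolding assms(3) by auto
qed

lemma prod_graph_of:
  fixes q :: "'a \<Rightarrow> 'a \<Rightarrow> real"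
  shows "(\<Prod>(u, w)\<in>parcs (graph_of V r f). q u w) = (\<Prod>u\<in>V - {r}. q u (f u))"
  by (simp add: prod.reindex inj_on_def)

lemma bij_betw_graph_of:
  assumes D: "pair_digraph D" and r: "r \<in> pverts D"
  shows "bij_betw (graph_of (pverts D) r)
    {f \<in> forests (pverts D) {r}. \<forall>u\<in>pverts D - {r}. (u, f u) \<in> parcs D}
    (oriented_spanning_trees D r)"
proof (rule bij_betw_imageI)
  let ?F = "{f \<in> forests (pverts D) {r}. \<forall>u\<in>pverts D - {r}. (u, f u) \<in> parcs D}"
  show "inj_on (graph_of (pverts D) r) ?F"
    by (rule inj_onI) (blast intro: graph_of_eq_imp)
  show "graph_of (pverts D) r ` ?F = oriented_spanning_trees D r"
  proof (rule set_eqI, rule iffI)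
    fix T assume "T \<in> graph_of (pverts D) r ` ?F"
    then obtain f where f: "f \<in> ?F" "T = graph_of (pverts D) r f" by blast
    show "T \<in> oriented_spanning_trees D r"
      unfolding f(2) using f(1) by (intro graph_of_oriented_spanning_tree[OF D r]) simp_all
  next
    fix T assume T: "T \<in> oriented_spanning_trees D r"
    obtain f where "f \<in> forests (pverts D) {r}"
      "\<And>u. u \<in> pverts D - {r} \<Longrightarrow> (u, f u) \<in> parcs D" "T = graph_of (pverts D) r f"
      by (rule oriented_spanning_treeE[OF D r T]) blast
    then show "T \<in> graph_of (pverts D) r ` ?F" by blast
  qed
qed

text \<open>A forest using an arc outside \<open>A\<close> has a zero factor and drops out.\<close>

lemma forest_sum_restrict_arcs:
  fixes q :: "'a \<Rightarrow> 'a \<Rightarrow> real"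
  assumes V: "finite V"
  shows "forest_sum V R (\<lambda>u w. if (u, w) \<in> A then q u w else 0) =
    (\<Sum>f | f \<in> forests V R \<and> (\<forall>u\<in>V - R. (u, f u) \<in> A). \<Prod>u\<in>V - R. q u (f u))"
proof -
  have prod: "(\<Prod>u\<in>V - R. if (u, f u) \<in> A then q u (f u) else 0) =
    (if \<forall>u\<in>V - R. (u, f u) \<in> A then \<Prod>u\<in>V - R. q u (f u) else 0)" for f
  proof (cases "\<forall>u\<in>V - R. (u, f u) \<in> A")
    case True
    then have "(\<Prod>u\<in>V - R. if (u, f u) \<in> A then q u (f u) else 0) = (\<Prod>u\<in>V - R. q u (f u))"
      by (intro prod.cong refl) simp
    then show ?thesis unfolding if_P[OF True] .
  next
    case False
    then obtain u where "u \<in> V - R" "(u, f u) \<notin> A" by blast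
    then have "(\<Prod>u\<in>V - R. if (u, f u) \<in> A then q u (f u) else 0) = 0"
      by (intro prod_zero finite_Diff[OF V] bexI[of _ u]) simp_all
    then show ?thesis unfolding if_not_P[OF False] .
  qed
  show ?thesis
    unfolding forest_sum_def prod by (rule sum.inter_filter[OF finite_forests[OF V], symmetric])
qed

text \<open>With \<open>q\<close> constantly 1 the left side counts trees; with \<open>q\<close> the
  weight of the head it is the tree sum over the quotient digraph.\<close>

lemma sum_oriented_spanning_trees:
  fixes q :: "'a \<Rightarrow> 'a \<Rightarrow> real"
  assumes D: "pair_digraph D" and r: "r \<in> pverts D"
  shows "(\<Sum>T\<in>oriented_spanning_trees D r. \<Prod>(u, w)\<in>parcs T. q u w) =
    forest_sum (pverts D) {r} (\<lambda>u w. if (u, w) \<in> parcs D then q u w else 0)"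
proof -
  have "(\<Sum>T\<in>oriented_spanning_trees D r. \<Prod>(u, w)\<in>parcs T. q u w) =
    (\<Sum>f | f \<in> forests (pverts D) {r} \<and> (\<forall>u\<in>pverts D - {r}. (u, f u) \<in> parcs D).
      \<Prod>(u, w)\<in>parcs (graph_of (pverts D) r f). q u w)"
    by (rule sum.reindex_bij_betw[OF bij_betw_graph_of[OF D r], symmetric])
  then show ?thesis
    unfolding prod_graph_of forest_sum_restrict_arcs[OF pair_digraphD(1)[OF D]] .
qed

section \<open>Blowing up the vertices of a weighted digraph\<close>

lemma forest_sum_cong:
  assumes "\<And>u s. u \<in> V - R \<Longrightarrow> s \<in> V \<Longrightarrow> P u s = Q u s"
  shows "forest_sum V R P = forest_sum V R Q"
  unfolding forest_sum_def using assms forestsD(2) by (intro sum.cong prod.cong) fastforce+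

lemma sum_merge:
  fixes f f' :: "'a \<Rightarrow> real"
  assumes "finite V" "x \<in> V" "y \<in> V" "x \<noteq> y" "f' x = f x + f y" "\<And>s. s \<in> V - {x, y} \<Longrightarrow> f' s = f s"
  shows "sum f' (V - {y}) = sum f V"
proof -
  have "sum f V = f y + (f x + sum f (V - {y} - {x}))"
    using assms by (subst sum.remove[of _ y], simp, simp, subst sum.remove[of _ x]) auto
  moreover have "sum f' (V - {y}) = f' x + sum f' (V - {y} - {x})"
    using assms by (intro sum.remove) auto
  moreover have "sum f' (V - {y} - {x}) = sum f (V - {y} - {x})"
    using assms by (intro sum.cong) auto
  ultimately show ?thesis using assms by simp
qed

lemma prod_update_factor:
  fixes f f' :: "'i \<Rightarrow> real"
  assumes "finite I" "i0 \<in> I" "f i0 = d * f' i0" "\<And>i. i \<in> I \<Longrightarrow> i \<noteq> i0 \<Longrightarrow> f' i = f i"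
  shows "prod f I = d * prod f' I"
proof -
  have "prod f (I - {i0}) = prod f' (I - {i0})" using assms(4) by (intro prod.cong) auto
  then show ?thesis
    using prod.remove[of I i0 f] prod.remove[of I i0 f'] assms by simp
qed

lemma card_group_remove:
  assumes "finite V" "y \<in> V"
  shows "card {x \<in> V - {y}. g x = i} = card {x \<in> V. g x = i} - (if i = g y then 1 else 0)"
proof -
  have "{x \<in> V - {y}. g x = i} = {x \<in> V. g x = i} - {y}" by auto
  with assms show ?thesis by (simp add: card_Diff_singleton_if)
qed

text \<open>The vertices \<open>i \<in> I\<close> of the quotient are blown up into the fibres of \<open>g\<close>; an arc into \<open>y\<close>
  carries the weight \<open>w y\<close>, and \<open>c\<close> weighs the arcs of the quotient.\<close>

locale blowup =
  fixes V :: "'v set" and r :: 'v and g :: "'v \<Rightarrow> 'i" and w :: "'v \<Rightarrow> real"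
    and c :: "'i \<Rightarrow> 'i \<Rightarrow> real" and I :: "'i set" and W :: "'i \<Rightarrow> real"
  assumes fin: "finite V" and root: "r \<in> V" and w_pos: "\<And>x. x \<in> V \<Longrightarrow> w x > 0"
    and I: "g ` V = I" and c0: "\<And>i. i \<in> I \<Longrightarrow> c i i = 0"
    and W: "\<And>j. j \<in> I \<Longrightarrow> (\<Sum>x\<in>V. if g x = j then w x else 0) = W j"
begin

abbreviation z :: "'i \<Rightarrow> real" where "z i \<equiv> \<Sum>j\<in>I. c i j * W j"

lemma fin_I: "finite I" using fin I by auto

lemma group_sum: "(\<Sum>t | t \<in> V \<and> g t = j. w t) = W j" if "j \<in> I"
  using W[OF that] fin by (simp add: sum.inter_filter)

text \<open>Grouping the heads by fibres shows that all vertices over \<open>i\<close> have the same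
  outgoing weight \<open>z i\<close> along arcs between fibres.\<close>

lemma out_weight_eq: "(\<Sum>s\<in>V. c i (g s) * w s) = z i"
proof -
  have "(\<Sum>s\<in>V. c i (g s) * w s) = (\<Sum>j\<in>g ` V. \<Sum>s | s \<in> V \<and> g s = j. c i (g s) * w s)"
    by (rule sum.image_gen[OF fin])
  also have "\<dots> = (\<Sum>j\<in>I. c i j * (\<Sum>s | s \<in> V \<and> g s = j. w s))"
    unfolding I by (intro sum.cong refl) (simp add: sum_distrib_left)
  also have "\<dots> = z i" by (intro sum.cong refl) (simp add: group_sum)
  finally show ?thesis .
qed

text \<open>Adding the weights preserves the fibre sums, and \<open>x\<close> keeps its fibre
  inhabited. So \<open>I\<close>, \<open>c\<close>, \<open>W\<close>, and with them all
  \<open>z i\<close>, stay fixed under repeated merging.\<close>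

lemma merge:
  assumes "x \<in> V" "y \<in> V" "x \<noteq> y" "g x = g y" "r \<noteq> y"
  shows "blowup (V - {y}) r g (w(x := w x + w y)) c I W"
proof
  have "g y \<in> g ` (V - {y})" using assms by (intro image_eqI[of _ _ x]) auto
  then show "g ` (V - {y}) = I" using I by blast
  show "(\<Sum>s\<in>V - {y}. if g s = j then (w(x := w x + w y)) s else 0) = W j" if "j \<in> I" for j
    unfolding W[OF that, symmetric] using assms fin by (intro sum_merge[of _ x]) auto
qed (use fin root w_pos c0 assms in \<open>auto simp: add_pos_pos\<close>)

lemma forest_sum_quotient:
  assumes "inj_on g V"
  shows "forest_sum V {r} (\<lambda>x y. c (g x) (g y) * w y) = forest_sum I {g r} (\<lambda>i j. c i j * W j)"
proof -
  have "(\<Sum>f\<in>forests V {r}. (\<Prod>u\<in>V - {r}. c (g u) (g (f u)) * w (f u)) * 1) =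
    (\<Sum>f\<in>forests I {g r}. (\<Prod>u\<in>I - {g r}. c u (f u) * W (f u)) * 1)"
  proof (rule sum_forests_transport[where \<mu> = g])
    have "g ` (V - {r}) = I - {g r}"
      using inj_on_image_set_diff[OF assms, of V "{r}"] root I by auto
    then show "bij_betw g (V - {r}) (I - {g r})"
      using inj_on_subset[OF assms, of "V - {r}"] by (auto simp: bij_betw_def)
    fix u s' assume s': "s' \<in> I"
    have "(\<Sum>t | t \<in> V \<and> g t = s'. c (g u) (g t) * w t) = c (g u) s' * (\<Sum>t | t \<in> V \<and> g t = s'. w t)"
      by (simp add: sum_distrib_left)
    with group_sum[OF s'] show "c (g u) s' * W s' = (\<Sum>t | t \<in> V \<and> g t = s'. c (g u) (g t) * w t)"
      by simp
  qed (use fin fin_I I root assms in \<open>auto dest: inj_onD\<close>)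
  then show ?thesis by (simp add: forest_sum_def)
qed

end

text \<open>Vertices of a common fibre are merged until all fibres are singletons. Each merge
  contributes \<open>z\<close>; a merge of \<open>y\<close> into the root also contributes
  \<open>w r / (w r + w y)\<close>, and these fractions telescope to
  \<open>w r / W (g r)\<close>.\<close>

lemma forest_sum_blowup:
  assumes "blowup V r g w c I W"
  shows "W (g r) * forest_sum V {r} (\<lambda>x y. c (g x) (g y) * w y) =
    w r * (\<Prod>i\<in>I. (\<Sum>j\<in>I. c i j * W j) ^ (card {x \<in> V. g x = i} - 1)) *
    forest_sum I {g r} (\<lambda>i j. c i j * W j)"
  using assms
proof (induction "card V" arbitrary: V w rule: less_induct)
  case less
  interpret blowup V r g w c I W by fact
  let ?k = "\<lambda>i. card {x \<in> V. g x = i}"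
  let ?S = "forest_sum I {g r} (\<lambda>i j. c i j * W j)"
  let ?F = "forest_sum V {r} (\<lambda>x y. c (g x) (g y) * w y)"
  show ?case
  proof (cases "inj_on g V")
    case True
    have "?k i = 1" if i: "i \<in> I" for i
    proof -
      obtain x where "x \<in> V" "g x = i" using i I by auto
      then have "{x \<in> V. g x = i} = {x}" using True by (auto dest: inj_onD)
      then show ?thesis by simp
    qed
    moreover have "W (g r) = w r"
    proof -
      have "{x \<in> V. g x = g r} = {r}" using True root by (auto dest: inj_onD)
      then show ?thesis using group_sum[of "g r"] root I by auto
    qed
    ultimately show ?thesis using forest_sum_quotient[OF True] by simp
  next
    case False
    \<comment> \<open>Of two distinct vertices at most one is the root, so the vertex
      \<open>y\<close> to be removed can be taken different from \<open>r\<close>.\<close>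
    then obtain x y where xy: "x \<in> V" "y \<in> V" "x \<noteq> y" "g x = g y" "r \<noteq> y"
      unfolding inj_on_def by metis
    let ?w = "w(x := w x + w y)"
    let ?V = "V - {y}"
    let ?k' = "\<lambda>i. card {x \<in> ?V. g x = i}"
    let ?P' = "\<lambda>u s. c (g u) (g s) * ?w s"
    interpret m: blowup ?V r g ?w c I W by (rule merge[OF xy])
    have "card ?V < card V" using fin xy by (intro psubset_card_mono) auto
    from less.hyps[OF this m.blowup_axioms]
    have IH: "W (g r) * forest_sum ?V {r} ?P' = ?w r * (\<Prod>i\<in>I. z i ^ (?k' i - 1)) * ?S" .
    have gy: "g y \<in> I" using xy I by auto
    have "2 \<le> ?k (g y)"
    proof -
      have "card {x, y} \<le> ?k (g y)" using xy fin by (intro card_mono) auto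
      with xy show ?thesis by simp
    qed
    \<comment> \<open>The fibre has at least two elements, so the truncated subtraction is exact and
      the exponent falls by one.\<close>
    then have "?k (g y) - 1 = Suc (?k' (g y) - 1)"
      unfolding card_group_remove[OF fin xy(2)] by simp
    then have prod: "(\<Prod>i\<in>I. z i ^ (?k i - 1)) = z (g y) * (\<Prod>i\<in>I. z i ^ (?k' i - 1))"
      unfolding card_group_remove[OF fin xy(2)]
      using fin_I gy by (intro prod_update_factor[of _ "g y"]) auto
    have row: "(\<Sum>s\<in>V. c (g y) (g s) * w s) = z (g y)" by (rule out_weight_eq)
    show ?thesis
    proof (cases "x = r")
      case True
      have "(w r + w y) * ?F = (w r * (\<Sum>s\<in>V. c (g y) (g s) * w s) + 0 * (w r + w y)) * forest_sum ?V {r} ?P'"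
        using xy True fin c0 gy by (intro forest_sum_merge_root) (auto simp: algebra_simps)
      then have "(w r + w y) * (W (g r) * ?F) = w r * z (g y) * (W (g r) * forest_sum ?V {r} ?P')"
        unfolding row by (simp add: mult_ac)
      also have "\<dots> = (w r + w y) * (w r * (z (g y) * (\<Prod>i\<in>I. z i ^ (?k' i - 1))) * ?S)"
        unfolding IH using True by simp
      finally have "(w r + w y) * (W (g r) * ?F) =
        (w r + w y) * (w r * (\<Prod>i\<in>I. z i ^ (?k i - 1)) * ?S)"
        unfolding prod .
      moreover have "w r + w y \<noteq> 0" using w_pos[OF root] w_pos[OF xy(2)] by simp
      ultimately show ?thesis by simp
    next
      case False
      have "?F = ((\<Sum>s\<in>V. c (g y) (g s) * w s) + 0) * forest_sum ?V {r} ?P'"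
        using xy False fin root by (intro forest_sum_merge_nonroots[of _ x]) (auto simp: algebra_simps)
      then have "W (g r) * ?F = z (g y) * (W (g r) * forest_sum ?V {r} ?P')"
        unfolding row by (simp add: mult_ac)
      also have "\<dots> = w r * (z (g y) * (\<Prod>i\<in>I. z i ^ (?k' i - 1))) * ?S"
        unfolding IH using False by simp
      finally show ?thesis unfolding prod .
    qed
  qed
qed

section \<open>Blow-ups with matched pairs inside the fibres\<close>

locale matched_blowup = blowup +
  fixes M :: "('a \<times> 'a) set"
  assumes M_V: "M \<subseteq> V \<times> V"
    and M_group: "\<And>x y. (x, y) \<in> M \<Longrightarrow> g x = g y \<and> x \<noteq> y"
    and M_disjoint: "\<And>x y x' y'. (x, y) \<in> M \<Longrightarrow> (x', y') \<in> M \<Longrightarrow> {x, y} \<inter> {x', y'} \<noteq> {} \<Longrightarrow> x = x' \<and> y = y'"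
begin

text \<open>Arcs of \<open>M\<close> keep the weight 1, whereas arcs between fibres carry the weight
  of their head, which grows under merging.\<close>

definition P :: "'a \<Rightarrow> 'a \<Rightarrow> real" where
  "P x y = c (g x) (g y) * w y + (if (x, y) \<in> M then 1 else 0)"

text \<open>In a fibre with \<open>m\<close> vertices and \<open>a\<close> arcs of \<open>M\<close>,
  contracting the matched pairs gives \<open>1 + z i\<close> for each of them, and the
  \<open>m - a - 1\<close> further merges give \<open>z i\<close> each.\<close>

definition factor :: "'b \<Rightarrow> real" where
  "factor i = z i ^ (card {x \<in> V. g x = i} - card {e \<in> M. g (fst e) = i} - 1) *
    (1 + z i) ^ card {e \<in> M. g (fst e) = i}"

lemma fin_M: "finite M"
  using M_V fin finite_subset by blast

text \<open>\<open>k\<close> is the end that is kept and \<open>d\<close> the one removed. Both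
  orders are allowed because the root must be kept whether it is the tail or the head.\<close>

lemma merge_matched:
  assumes e: "(x, y) \<in> M" and kd: "(k, d) = (x, y) \<or> (k, d) = (y, x)" and "r \<noteq> d"
  shows "matched_blowup (V - {d}) r g (w(k := w k + w d)) c I W (M - {(x, y)})"
    and "prod factor I = (1 + z (g k)) *
      prod (matched_blowup.factor (V - {d}) g c I W (M - {(x, y)})) I"
proof -
  have V: "x \<in> V" "y \<in> V" "x \<noteq> y" "g x = g y" using M_V M_group e by auto
  interpret m: blowup "V - {d}" r g "w(k := w k + w d)" c I W
    using V kd assms(3) by (intro merge) auto
  interpret mm: matched_blowup "V - {d}" r g "w(k := w k + w d)" c I W "M - {(x, y)}"
  proof
    show "M - {(x, y)} \<subseteq> (V - {d}) \<times> (V - {d})"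
    proof (rule subrelI)
      fix x' y' assume e': "(x', y') \<in> M - {(x, y)}"
      with M_disjoint[OF e, of x' y'] have "{x, y} \<inter> {x', y'} = {}" by blast
      with kd M_V e' show "(x', y') \<in> (V - {d}) \<times> (V - {d})" by auto
    qed
    show "g x' = g y' \<and> x' \<noteq> y'" if "(x', y') \<in> M - {(x, y)}" for x' y'
      using M_group that by auto
    show "x1 = x2 \<and> y1 = y2" if "(x1, y1) \<in> M - {(x, y)}" "(x2, y2) \<in> M - {(x, y)}"
      "{x1, y1} \<inter> {x2, y2} \<noteq> {}" for x1 y1 x2 y2
      using M_disjoint that by blast
  qed
  show "matched_blowup (V - {d}) r g (w(k := w k + w d)) c I W (M - {(x, y)})" ..
  have d: "d \<in> V" "g d = g x" "g k = g x" using kd V by auto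
  have "{e' \<in> M - {(x, y)}. g (fst e') = i} = {e' \<in> M. g (fst e') = i} - {(x, y)}" for i by auto
  then have a: "card {e' \<in> M - {(x, y)}. g (fst e') = i} =
      card {e' \<in> M. g (fst e') = i} - (if i = g x then 1 else 0)" for i
    using e fin_M by (auto simp: card_Diff_singleton_if)
  have "card {e' \<in> M. g (fst e') = g x} \<noteq> 0" using e fin_M by auto
  \<comment> \<open>The fibre loses one vertex and one arc at once, so the exponent of
    \<open>z\<close> is unchanged and only the power of \<open>1 + z\<close> drops.\<close>
  then obtain n where n: "card {e' \<in> M. g (fst e') = g x} = Suc n" by (cases "card {e' \<in> M. g (fst e') = g x}") auto
  show "prod factor I = (1 + z (g k)) * prod mm.factor I"
  proof (rule prod_update_factor[of _ "g x"])
    show "factor (g x) = (1 + z (g k)) * mm.factor (g x)"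
      unfolding factor_def mm.factor_def a card_group_remove[OF fin d(1)] using d n by simp
    show "mm.factor i = factor i" if "i \<noteq> g x" for i
      unfolding factor_def mm.factor_def a card_group_remove[OF fin d(1)] using d that by simp
  qed (use fin_I I V in auto)
qed

lemma matched_tail_iff: "(x, y) \<in> M \<Longrightarrow> (x, s) \<in> M \<longleftrightarrow> s = y"
  using M_disjoint[of x y x s] by force

lemma matched_head_no_tail:
  assumes "(x, y) \<in> M"
  shows "(y, s) \<notin> M"
proof
  assume "(y, s) \<in> M"
  from M_disjoint[OF assms this] M_group[OF assms] show False by simp
qed

lemma not_matched:
  assumes "(x, y) \<in> M" "u \<noteq> x" "s = x \<or> s = y"
  shows "(u, s) \<notin> M"
proof
  assume "(u, s) \<in> M"
  from M_disjoint[OF assms(1) this] assms(2,3) show False by auto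
qed

lemma P_row_tail:
  assumes "(x, y) \<in> M"
  shows "P x s = c (g x) (g s) * w s + (if s = y then 1 else 0)"
  using matched_tail_iff[OF assms] by (simp add: P_def)

lemma P_row_head:
  assumes "(x, y) \<in> M"
  shows "P y s = c (g x) (g s) * w s"
  using matched_head_no_tail[OF assms] M_group[OF assms] by (simp add: P_def)

text \<open>Outside the row of \<open>x\<close> the columns of \<open>x\<close> and \<open>y\<close>
  are in the ratio \<open>w x : w y\<close>, as the merge into the root requires.\<close>

lemma P_col:
  assumes "(x, y) \<in> M" "u \<noteq> x" "s = x \<or> s = y"
  shows "P u s = c (g u) (g x) * w s"
  using not_matched[OF assms] M_group[OF assms(1)] assms(3) by (auto simp: P_def)

text \<open>The contracted arc disappears, the merged vertex inherits the common row, and the two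
  columns add up; these are the conditions on \<open>P'\<close> in both merging lemmas.\<close>

lemma P_merge:
  assumes e: "(x, y) \<in> M" and kd: "(k, d) = (x, y) \<or> (k, d) = (y, x)"
  defines "P' \<equiv> matched_blowup.P g (w(k := w k + w d)) c (M - {(x, y)})"
  assumes m: "matched_blowup (V - {d}) r g (w(k := w k + w d)) c I W (M - {(x, y)})"
  shows "s \<noteq> x \<Longrightarrow> s \<noteq> y \<Longrightarrow> P' k s = c (g x) (g s) * w s"
    and "u \<noteq> x \<Longrightarrow> u \<noteq> y \<Longrightarrow> s \<noteq> x \<Longrightarrow> s \<noteq> y \<Longrightarrow> P' u s = P u s"
    and "u \<noteq> x \<Longrightarrow> u \<noteq> y \<Longrightarrow> P' u k = P u k + P u d"
proof -
  interpret m: matched_blowup "V - {d}" r g "w(k := w k + w d)" c I W "M - {(x, y)}" by fact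
  have P': "P' u s = c (g u) (g s) * (w(k := w k + w d)) s + (if (u, s) \<in> M - {(x, y)} then 1 else 0)" for u s
    unfolding P'_def by (rule m.P_def)
  have gxy: "g x = g y" using M_group[OF e] by simp
  show "P' k s = c (g x) (g s) * w s" if "s \<noteq> x" "s \<noteq> y"
    using matched_tail_iff[OF e, of s] matched_head_no_tail[OF e, of s] that kd gxy by (auto simp: P')
  show "P' u s = P u s" if "u \<noteq> x" "u \<noteq> y" "s \<noteq> x" "s \<noteq> y"
    using that kd by (auto simp: P' P_def)
  show "P' u k = P u k + P u d" if "u \<noteq> x" "u \<noteq> y"
    using kd that P_col[OF e that(1), of k] P_col[OF e that(1), of d]
      not_matched[OF e that(1), of k] not_matched[OF e that(1), of d] gxy
    by (auto simp: P' algebra_simps)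
qed

end

text \<open>An unmatched root means that both ends of every arc of \<open>M\<close> are non-roots,
  so each contraction gives \<open>1 + z\<close>. Once \<open>M\<close> is empty, a plain blow-up
  remains.\<close>

lemma forest_sum_matched_blowup:
  assumes "matched_blowup V r g w c I W M" "r \<notin> Field M"
  shows "W (g r) * forest_sum V {r} (matched_blowup.P g w c M) =
    w r * prod (matched_blowup.factor V g c I W M) I * forest_sum I {g r} (\<lambda>i j. c i j * W j)"
  using assms
proof (induction "card M" arbitrary: V w M)
  case 0
  interpret matched_blowup V r g w c I W M by fact
  have "M = {}" using 0 fin_M by simp
  then have "P = (\<lambda>x y. c (g x) (g y) * w y)" "factor = (\<lambda>i. z i ^ (card {x \<in> V. g x = i} - 1))"
    unfolding fun_eq_iff P_def factor_def by simp_all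
  then show ?case using forest_sum_blowup[OF blowup_axioms] by simp
next
  case (Suc n)
  interpret matched_blowup V r g w c I W M by fact
  obtain x y where e: "(x, y) \<in> M" using Suc(2) by (metis card.empty equals0I old.prod.exhaust nat.distinct(1))
  have xy: "x \<in> V" "y \<in> V" "x \<noteq> y" "g x = g y" using M_V M_group e by auto
  have r: "r \<noteq> x" "r \<noteq> y" using Suc.prems(2) e by (auto simp: Field_def)
  have m: "matched_blowup (V - {y}) r g (w(x := w x + w y)) c I W (M - {(x, y)})"
    and factor: "prod factor I = (1 + z (g x)) *
      prod (matched_blowup.factor (V - {y}) g c I W (M - {(x, y)})) I"
    using merge_matched[OF e, of x y] r by auto
  interpret m: matched_blowup "V - {y}" r g "w(x := w x + w y)" c I W "M - {(x, y)}" by fact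
  have "card (M - {(x, y)}) = n" using Suc(2) e fin_M by simp
  moreover have "r \<notin> Field (M - {(x, y)})" using Suc.prems(2) by (auto simp: Field_def)
  ultimately have IH: "W (g r) * forest_sum (V - {y}) {r} m.P =
    (w(x := w x + w y)) r * prod m.factor I * forest_sum I {g r} (\<lambda>i j. c i j * W j)"
    using Suc.hyps(1)[of "M - {(x, y)}"] m by blast
  \<comment> \<open>The tail \<open>x\<close> is kept: its row is that of \<open>y\<close> plus an
    arc of weight \<epsilon> = 1 to \<open>y\<close>.\<close>
  have "forest_sum V {r} P = ((\<Sum>s\<in>V. c (g x) (g s) * w s) + 1) * forest_sum (V - {y}) {r} m.P"
    using xy r fin root P_row_tail[OF e] P_row_head[OF e] P_merge[OF e _ m]
    by (intro forest_sum_merge_nonroots[of _ x]) auto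
  then have "W (g r) * forest_sum V {r} P = (1 + z (g x)) * (W (g r) * forest_sum (V - {y}) {r} m.P)"
    unfolding out_weight_eq by (simp add: algebra_simps)
  then show ?case unfolding IH factor using r by simp
qed

context matched_blowup
begin

text \<open>Here \<epsilon> = 1 for the arc from \<open>x\<close> to the root, and the merge
  contributes \<open>w r * z + (w r + w x)\<close>, up to the share denominator. The factor
  \<open>1 + z (g r)\<close> on the left completes the product of the remaining factors to the full
  one.\<close>

lemma forest_sum_root_head:
  assumes e: "(x, r) \<in> M"
  shows "(1 + z (g r)) * (W (g r) * forest_sum V {r} P) =
    (w r * (1 + z (g r)) + w x) * prod factor I * forest_sum I {g r} (\<lambda>i j. c i j * W j)"
proof -
  have xr: "x \<in> V" "r \<noteq> x" "g x = g r" using M_V M_group e by auto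
  have m: "matched_blowup (V - {x}) r g (w(r := w r + w x)) c I W (M - {(x, r)})"
    and factor: "prod factor I = (1 + z (g r)) *
      prod (matched_blowup.factor (V - {x}) g c I W (M - {(x, r)})) I"
    using merge_matched[OF e, of r x] xr by auto
  interpret m: matched_blowup "V - {x}" r g "w(r := w r + w x)" c I W "M - {(x, r)}" by fact
  \<comment> \<open>The arcs of \<open>M\<close> are disjoint, so the root is unmatched once its own
    arc is removed.\<close>
  have "r \<notin> Field (M - {(x, r)})"
    using M_disjoint[OF e] by (auto simp: Field_def)
  from forest_sum_matched_blowup[OF m this]
  have F': "W (g r) * forest_sum (V - {x}) {r} m.P =
    (w r + w x) * prod m.factor I * forest_sum I {g r} (\<lambda>i j. c i j * W j)" by simp
  have gr: "g r \<in> I" using root I by auto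
  have "(w r + w x) * forest_sum V {r} P =
    (w r * (\<Sum>s\<in>V. c (g x) (g s) * w s) + 1 * (w r + w x)) * forest_sum (V - {x}) {r} m.P"
    using xr fin root c0[OF gr] P_row_tail[OF e] P_merge[OF e _ m] P_col[OF e]
    by (intro forest_sum_merge_root) auto
  then have "(w r + w x) * (W (g r) * forest_sum V {r} P) =
    (w r * (1 + z (g r)) + w x) * (W (g r) * forest_sum (V - {x}) {r} m.P)"
    unfolding out_weight_eq xr(3) by (simp add: algebra_simps)
  also have "\<dots> = (w r + w x) * ((w r * (1 + z (g r)) + w x) * prod m.factor I * forest_sum I {g r} (\<lambda>i j. c i j * W j))"
    unfolding F' by simp
  finally have "W (g r) * forest_sum V {r} P =
      (w r * (1 + z (g r)) + w x) * prod m.factor I * forest_sum I {g r} (\<lambda>i j. c i j * W j)"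
    using w_pos[OF root] w_pos[OF xr(1)] by simp
  then show ?thesis unfolding factor by simp
qed

text \<open>No tree contains an arc leaving its root, so here \<epsilon> = 0 and the merge
  contributes only \<open>w r * z\<close>, up to the share denominator.\<close>

lemma forest_sum_root_tail:
  assumes e: "(r, y) \<in> M"
  shows "(1 + z (g r)) * (W (g r) * forest_sum V {r} P) =
    w r * z (g r) * prod factor I * forest_sum I {g r} (\<lambda>i j. c i j * W j)"
proof -
  have yr: "y \<in> V" "r \<noteq> y" "g r = g y" using M_V M_group e by auto
  have m: "matched_blowup (V - {y}) r g (w(r := w r + w y)) c I W (M - {(r, y)})"
    and factor: "prod factor I = (1 + z (g r)) *
      prod (matched_blowup.factor (V - {y}) g c I W (M - {(r, y)})) I"
    using merge_matched[OF e, of r y] yr by auto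
  interpret m: matched_blowup "V - {y}" r g "w(r := w r + w y)" c I W "M - {(r, y)}" by fact
  have "r \<notin> Field (M - {(r, y)})"
    using M_disjoint[OF e] by (auto simp: Field_def)
  from forest_sum_matched_blowup[OF m this]
  have F': "W (g r) * forest_sum (V - {y}) {r} m.P =
    (w r + w y) * prod m.factor I * forest_sum I {g r} (\<lambda>i j. c i j * W j)" by simp
  have gr: "g r \<in> I" using root I by auto
  have "(w r + w y) * forest_sum V {r} P =
    (w r * (\<Sum>s\<in>V. c (g r) (g s) * w s) + 0 * (w r + w y)) * forest_sum (V - {y}) {r} m.P"
    using yr fin root c0[OF gr] P_row_head[OF e] P_merge[OF e _ m] P_col[OF e]
    by (intro forest_sum_merge_root) auto
  then have "(w r + w y) * (W (g r) * forest_sum V {r} P) =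
    w r * z (g r) * (W (g r) * forest_sum (V - {y}) {r} m.P)"
    unfolding out_weight_eq by (simp add: algebra_simps)
  also have "\<dots> = (w r + w y) * (w r * z (g r) * prod m.factor I * forest_sum I {g r} (\<lambda>i j. c i j * W j))"
    unfolding F' by simp
  finally have "W (g r) * forest_sum V {r} P =
      w r * z (g r) * prod m.factor I * forest_sum I {g r} (\<lambda>i j. c i j * W j)"
    using w_pos[OF root] w_pos[OF yr(1)] by simp
  then show ?thesis unfolding factor by simp
qed

end

section \<open>Generalized joins\<close>

lemma generalized_join_simps:
  "pverts (generalized_join G H) = (SIGMA i:pverts G. pverts (H i))"
  "((i, u), (j, s)) \<in> parcs (generalized_join G H) \<longleftrightarrow>
    i \<in> pverts G \<and> j \<in> pverts G \<and> u \<in> pverts (H i) \<and> s \<in> pverts (H j) \<and>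
    (i = j \<and> (u, s) \<in> parcs (H i) \<or> i \<noteq> j \<and> (i, j) \<in> parcs G)"
  by (auto simp: generalized_join_def)

lemma pair_digraph_generalized_join:
  assumes "pair_digraph G" "\<And>i. i \<in> pverts G \<Longrightarrow> pair_digraph (H i)"
  shows "pair_digraph (generalized_join G H)"
proof -
  let ?J = "generalized_join G H"
  have fin: "finite (pverts ?J)"
    unfolding generalized_join_simps
    using finite_SigmaI[OF pair_digraphD(1)[OF assms(1)] pair_digraphD(1)[OF assms(2)]] by simp
  have "parcs ?J \<subseteq> pverts ?J \<times> pverts ?J"
    by (auto simp: generalized_join_def)
  then have "finite (parcs ?J)" using finite_cartesian_product[OF fin fin] by (rule finite_subset)
  moreover have "fst e \<noteq> snd e" if "e \<in> parcs ?J" for e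
  proof
    obtain i u where "fst e = (i, u)" by fastforce
    moreover assume "fst e = snd e"
    ultimately have "e = ((i, u), (i, u))" by (simp add: prod_eq_iff)
    with that have "i \<in> pverts G" "(u, u) \<in> parcs (H i)" by (auto simp: generalized_join_simps)
    then show False using pair_digraphD(4)[OF assms(2), of i u] by simp
  qed
  ultimately show ?thesis
    using fin by unfold_locales (auto simp: generalized_join_def)
qed

definition arc_indicator :: "'i pair_pre_digraph \<Rightarrow> 'i \<Rightarrow> 'i \<Rightarrow> real" where
  "arc_indicator G i j = (if (i, j) \<in> parcs G then 1 else 0)"

definition join_inner_arcs ::
  "'i pair_pre_digraph \<Rightarrow> ('i \<Rightarrow> 'a pair_pre_digraph) \<Rightarrow> (('i \<times> 'a) \<times> ('i \<times> 'a)) set" where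
  "join_inner_arcs G H = {((i, u), (i, u')) | i u u'. i \<in> pverts G \<and> (u, u') \<in> parcs (H i)}"

lemma join_inner_arcs_iff:
  "((i, u), (j, u')) \<in> join_inner_arcs G H \<longleftrightarrow> i = j \<and> i \<in> pverts G \<and> (u, u') \<in> parcs (H i)"
  by (auto simp: join_inner_arcs_def)

lemma card_join_fibre:
  "i \<in> pverts G \<Longrightarrow> card {x \<in> pverts (generalized_join G H). fst x = i} = card (pverts (H i))"
proof -
  assume i: "i \<in> pverts G"
  have "{x \<in> pverts (generalized_join G H). fst x = i} = Pair i ` pverts (H i)"
    using i by (auto simp: generalized_join_simps)
  then show ?thesis by (simp add: card_image inj_on_def)
qed

lemma card_join_inner_arcs:
  "i \<in> pverts G \<Longrightarrow> card {e \<in> join_inner_arcs G H. fst (fst e) = i} = card (parcs (H i))"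
proof -
  assume i: "i \<in> pverts G"
  have "{e \<in> join_inner_arcs G H. fst (fst e) = i} = (\<lambda>(u, u'). ((i, u), (i, u'))) ` parcs (H i)"
    using i by (auto simp: join_inner_arcs_def)
  moreover have "inj_on (\<lambda>(u, u'). ((i, u), (i, u'))) (parcs (H i))" by (auto simp: inj_on_def)
  ultimately show ?thesis by (simp add: card_image)
qed

lemma sum_arc_indicator:
  assumes "pair_digraph G"
  shows "(\<Sum>j\<in>pverts G. arc_indicator G i j * real (m j)) = real (out_weight G m i)"
proof -
  note fin = pair_digraphD(1)[OF assms] and wf = pair_digraphD(3)[OF assms]
  have "(\<Sum>j\<in>pverts G. arc_indicator G i j * real (m j)) =
    (\<Sum>j\<in>pverts G. if (i, j) \<in> parcs G then real (m j) else 0)"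
    by (intro sum.cong) (auto simp: arc_indicator_def)
  also have "\<dots> = (\<Sum>j | j \<in> pverts G \<and> (i, j) \<in> parcs G. real (m j))"
    by (rule sum.inter_filter[OF fin, symmetric])
  also have "{j. j \<in> pverts G \<and> (i, j) \<in> parcs G} = {j. (i, j) \<in> parcs G}"
    using pair_wf_digraph.in_arcsD2[OF wf] by blast
  finally show ?thesis by (simp add: out_weight_def)
qed

lemma sum_oriented_spanning_trees_head_weight:
  assumes "pair_digraph G" "r \<in> pverts G"
  shows "(\<Sum>T\<in>oriented_spanning_trees G r. \<Prod>(i, j)\<in>parcs T. real (m j)) =
    forest_sum (pverts G) {r} (\<lambda>i j. arc_indicator G i j * real (m j))"
  unfolding sum_oriented_spanning_trees[OF assms]
  by (intro forest_sum_cong) (simp add: arc_indicator_def)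

text \<open>The join is the blow-up of \<open>G\<close> along \<open>fst\<close> with unit vertex
  weights, the arcs inside the \<open>H i\<close> forming the matching.\<close>

lemma matched_blowup_generalized_join:
  assumes G: "pair_digraph G"
    and H: "\<And>i. i \<in> pverts G \<Longrightarrow> pair_digraph (H i)"
    and nonempty: "\<And>i. i \<in> pverts G \<Longrightarrow> pverts (H i) \<noteq> {}"
    and card: "\<And>i. i \<in> pverts G \<Longrightarrow> card (pverts (H i)) = m i"
    and disjoint: "\<And>i x y x' y'. i \<in> pverts G \<Longrightarrow> (x, y) \<in> parcs (H i) \<Longrightarrow> (x', y') \<in> parcs (H i) \<Longrightarrow>
      {x, y} \<inter> {x', y'} \<noteq> {} \<Longrightarrow> x = x' \<and> y = y'"
    and r: "r \<in> pverts (generalized_join G H)"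
  shows "matched_blowup (pverts (generalized_join G H)) r fst (\<lambda>_. 1) (arc_indicator G)
    (pverts G) (\<lambda>i. real (m i)) (join_inner_arcs G H)"
proof
  let ?V = "pverts (generalized_join G H)"
  let ?M = "join_inner_arcs G H"
  have V: "?V = (SIGMA i:pverts G. pverts (H i))" by (rule generalized_join_simps)
  have "pair_digraph (generalized_join G H)"
    using G H by (rule pair_digraph_generalized_join)
  then show fin: "finite ?V" by (rule pair_digraphD)
  show "r \<in> ?V" by (rule r)
  show "fst ` ?V = pverts G" using nonempty by (force simp: V)
  show "(\<Sum>x\<in>?V. if fst x = j then 1 else 0) = real (m j)" if "j \<in> pverts G" for j
    using card_join_fibre[OF that, of H] card[OF that] fin by (simp add: sum.inter_filter[symmetric])
  have wf: "pair_wf_digraph (H i)" if "i \<in> pverts G" for i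
    using H[OF that] by (rule pair_digraphD)
  show "arc_indicator G i i = 0" for i
    using pair_digraphD(4)[OF G, of i] by (simp add: arc_indicator_def)
  show "?M \<subseteq> ?V \<times> ?V"
    using pair_wf_digraph.in_arcsD1[OF wf] pair_wf_digraph.in_arcsD2[OF wf]
    by (auto simp: V join_inner_arcs_def)
  fix x y assume xy: "(x, y) \<in> ?M"
  then obtain i u u' where e: "x = (i, u)" "y = (i, u')" "i \<in> pverts G" "(u, u') \<in> parcs (H i)"
    by (auto simp: join_inner_arcs_def)
  show "fst x = fst y \<and> x \<noteq> y" using e pair_digraphD(4)[OF H[OF e(3)], of u] by auto
  fix x' y' assume "(x', y') \<in> ?M" and meet: "{x, y} \<inter> {x', y'} \<noteq> {}"
  then obtain w w' where e': "x' = (i, w)" "y' = (i, w')" "(w, w') \<in> parcs (H i)"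
    using e by (auto simp: join_inner_arcs_def)
  have "{u, u'} \<inter> {w, w'} \<noteq> {}" using meet e(1,2) e'(1,2) by auto
  from disjoint[OF e(3,4) e'(3) this] show "x = x' \<and> y = y'" using e e' by simp
qed simp

lemma num_oriented_spanning_trees_generalized_join:
  assumes G: "pair_digraph G"
    and H: "\<And>i. i \<in> pverts G \<Longrightarrow> pair_digraph (H i)"
    and r: "r \<in> pverts (generalized_join G H)"
    and blowup: "matched_blowup (pverts (generalized_join G H)) r fst (\<lambda>_. 1) (arc_indicator G)
      (pverts G) W (join_inner_arcs G H)"
  shows "real (num_oriented_spanning_trees (generalized_join G H) r) =
    forest_sum (pverts (generalized_join G H)) {r}
      (matched_blowup.P fst (\<lambda>_. 1) (arc_indicator G) (join_inner_arcs G H))"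
proof -
  let ?J = "generalized_join G H"
  have J: "pair_digraph ?J" using G H by (rule pair_digraph_generalized_join)
  have "real (num_oriented_spanning_trees ?J r) =
    forest_sum (pverts ?J) {r} (\<lambda>x y. if (x, y) \<in> parcs ?J then 1 else 0)"
    using sum_oriented_spanning_trees[OF J r, of "\<lambda>_ _. 1"]
    by (simp add: num_oriented_spanning_trees_def)
  also have "\<dots> = forest_sum (pverts ?J) {r}
      (matched_blowup.P fst (\<lambda>_. 1) (arc_indicator G) (join_inner_arcs G H))"
  proof (rule forest_sum_cong)
    fix x y assume xy: "x \<in> pverts ?J - {r}" "y \<in> pverts ?J"
    obtain i u where x: "x = (i, u)" by (cases x)
    obtain j u' where y: "y = (j, u')" by (cases y)
    \<comment> \<open>Arcs inside a fibre come from \<open>H i\<close>, arcs between fibres from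
      \<open>G\<close>. As \<open>G\<close> has no loops, at most one summand of \<open>P\<close> is
      nonzero.\<close>
    show "(if (x, y) \<in> parcs ?J then 1 else 0) =
      matched_blowup.P fst (\<lambda>_. 1) (arc_indicator G) (join_inner_arcs G H) x y"
      using xy pair_digraphD(4)[OF G, of i]
      unfolding matched_blowup.P_def[OF blowup] x y generalized_join_simps join_inner_arcs_iff
        arc_indicator_def by auto
  qed
  finally show ?thesis .
qed

lemma images_meet: "f ` A \<inter> f ` B \<noteq> {} \<Longrightarrow> \<exists>s\<in>A. \<exists>t\<in>B. f s = f t"
  by blast

text \<open>The label pairs \<open>{2 * s - 1, 2 * s}\<close> are disjoint for different
  \<open>s\<close> and stay within the range \<open>{1..k}\<close> on which \<open>v\<close> is
  injective.\<close>

lemma labelled_matching: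
  fixes v :: "nat \<Rightarrow> 'a"
  assumes inj: "inj_on v {1..k}" and k: "2 * l \<le> k"
    and A: "A = {(v (2 * s - 1), v (2 * s)) | s. 1 \<le> s \<and> s \<le> l}"
  shows "card A = l"
    and "(x, y) \<in> A \<Longrightarrow> (x', y') \<in> A \<Longrightarrow> {x, y} \<inter> {x', y'} \<noteq> {} \<Longrightarrow> x = x' \<and> y = y'"
proof -
  have v_inj: "s = t" if "v s = v t" "s \<in> {1..k}" "t \<in> {1..k}" for s t
    using inj that by (auto dest: inj_onD)
  have "A = (\<lambda>s. (v (2 * s - 1), v (2 * s))) ` {1..l}"
    unfolding A by auto
  moreover have "inj_on (\<lambda>s. (v (2 * s - 1), v (2 * s))) {1..l}"
  proof (rule inj_onI)
    fix s t assume "s \<in> {1..l}" "t \<in> {1..l}"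
      "(v (2 * s - 1), v (2 * s)) = (v (2 * t - 1), v (2 * t))"
    then show "s = t" using v_inj[of "2 * s" "2 * t"] k by auto
  qed
  ultimately show "card A = l" by (simp add: card_image)
  assume arcs: "(x, y) \<in> A" "(x', y') \<in> A" and meet: "{x, y} \<inter> {x', y'} \<noteq> {}"
  from arcs obtain s t where s: "x = v (2 * s - 1)" "y = v (2 * s)" "1 \<le> s" "s \<le> l"
    and t: "x' = v (2 * t - 1)" "y' = v (2 * t)" "1 \<le> t" "t \<le> l" unfolding A by auto
  have eqs: "{x, y} = v ` {2 * s - 1, 2 * s}" "{x', y'} = v ` {2 * t - 1, 2 * t}"
    using s t by simp_all
  obtain s' t' where st: "s' \<in> {2 * s - 1, 2 * s}" "t' \<in> {2 * t - 1, 2 * t}" "v s' = v t'"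
    using images_meet[OF meet[unfolded eqs]] by blast
  then have "s' = t'" using s t k by (intro v_inj) auto
  then have "s = t" using st s(3) t(3) by (auto; presburger)
  then show "x = x' \<and> y = y'" using s t by simp
qed

theorem theorem4p5:
  fixes G :: "nat pair_pre_digraph"
    and n :: nat
    and H :: "nat \<Rightarrow> 'a pair_pre_digraph"
    and m a b :: "nat \<Rightarrow> nat"
    and v :: "nat \<Rightarrow> nat \<Rightarrow> 'a"
    and istar p :: nat
    and z :: "nat \<Rightarrow> real"
    and S :: real
  assumes G: "pair_digraph G"
    and G_verts: "pverts G = {1..n}"
    and H: "\<And>i. i \<in> pverts G \<Longrightarrow> pair_digraph (H i)"
    and H_nonempty: "\<And>i. i \<in> pverts G \<Longrightarrow> pverts (H i) \<noteq> {}"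
    and H_card: "\<And>i. i \<in> pverts G \<Longrightarrow> card (pverts (H i)) = m i"
    and m: "\<And>i. i \<in> pverts G \<Longrightarrow> m i = 2 * a i + b i"
    and label: "\<And>i. i \<in> pverts G \<Longrightarrow> bij_betw (v i) {1..m i} (pverts (H i))"
    and H_arcs: "\<And>i. i \<in> pverts G \<Longrightarrow>
          parcs (H i) = {(v i (2 * s - 1), v i (2 * s)) | s. 1 \<le> s \<and> s \<le> a i}"
    and istar: "istar \<in> pverts G"
  defines "z \<equiv> \<lambda>i. real (out_weight G m i)"
    and "S \<equiv> (\<Sum>T \<in> oriented_spanning_trees G istar. \<Prod>(i, j) \<in> parcs T. real (m j))"
  shows
    "(1 \<le> p \<and> p \<le> 2 * a istar \<and> odd p \<longrightarrow>
        real (num_oriented_spanning_trees (generalized_join G H) (istar, v istar p)) =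
          z istar / (real (m istar) + real (m istar) * z istar) *
          (\<Prod>i \<in> pverts G. z i ^ (m i - a i - 1) * (1 + z i) ^ a i) * S) \<and>
     (1 \<le> p \<and> p \<le> 2 * a istar \<and> even p \<longrightarrow>
        real (num_oriented_spanning_trees (generalized_join G H) (istar, v istar p)) =
          (2 + z istar) / (real (m istar) + real (m istar) * z istar) *
          (\<Prod>i \<in> pverts G. z i ^ (m i - a i - 1) * (1 + z i) ^ a i) * S) \<and>
     (2 * a istar + 1 \<le> p \<and> p \<le> m istar \<longrightarrow>
        real (num_oriented_spanning_trees (generalized_join G H) (istar, v istar p)) =
          1 / real (m istar) *
          (\<Prod>i \<in> pverts G. z i ^ (m i - a i - 1) * (1 + z i) ^ a i) * S)"
proof -
  let ?J = "generalized_join G H"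
  let ?r = "(istar, v istar p)"
  let ?t = "real (num_oriented_spanning_trees ?J ?r)"
  let ?m = "real (m istar)"
  define X where "X = (\<Prod>i \<in> pverts G. z i ^ (m i - a i - 1) * (1 + z i) ^ a i)"
  have inj: "inj_on (v i) {1..m i}" and size: "2 * a i \<le> m i" if "i \<in> pverts G" for i
    using label[OF that] m[OF that] by (auto simp: bij_betw_def)
  note matching = labelled_matching[OF inj size H_arcs]
  have z: "(\<Sum>j\<in>pverts G. arc_indicator G i j * real (m j)) = z i" for i
    unfolding z_def by (rule sum_arc_indicator[OF G])
  have S: "forest_sum (pverts G) {istar} (\<lambda>i j. arc_indicator G i j * real (m j)) = S"
    unfolding S_def by (rule sum_oriented_spanning_trees_head_weight[OF G istar, symmetric])
  have r: "?r \<in> pverts ?J" if "1 \<le> p" "p \<le> m istar"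
    using bij_betwE[OF label[OF istar]] that istar by (simp add: generalized_join_simps)
  have blowup: "matched_blowup (pverts ?J) ?r fst (\<lambda>_. 1) (arc_indicator G) (pverts G)
    (\<lambda>i. real (m i)) (join_inner_arcs G H)" if "1 \<le> p" "p \<le> m istar"
    by (rule matched_blowup_generalized_join[OF G H H_nonempty H_card matching(2) r[OF that]])
  have factor: "prod (matched_blowup.factor (pverts ?J) fst (arc_indicator G) (pverts G)
    (\<lambda>i. real (m i)) (join_inner_arcs G H)) (pverts G) = X" if "1 \<le> p" "p \<le> m istar"
    unfolding X_def matched_blowup.factor_def[OF blowup[OF that]] z
    by (intro prod.cong refl) (simp add: card_join_fibre card_join_inner_arcs H_card matching(1))
  have count: "?t = forest_sum (pverts ?J) {?r}
    (matched_blowup.P fst (\<lambda>_. 1) (arc_indicator G) (join_inner_arcs G H))" if "1 \<le> p" "p \<le> m istar"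
    by (rule num_oriented_spanning_trees_generalized_join[OF G H r[OF that] blowup[OF that]])
  have pos: "?m * (1 + z istar) > 0"
  proof -
    have "1 \<le> m istar"
      using label[OF istar] H_nonempty[OF istar] by (cases "m istar") (auto simp: bij_betw_def)
    then show ?thesis by (simp add: z_def add_pos_nonneg)
  qed
  \<comment> \<open>The two matched cases arrive with cleared denominators; \<open>pos\<close>
    permits the division.\<close>
  have solve: "?t = q / (?m + ?m * z istar) * X * S"
    if eq: "(1 + z istar) * (?m * ?t) = q * X * S" for q
  proof -
    have nz: "?m + ?m * z istar \<noteq> 0" using pos by (simp add: distrib_left)
    have "?t * (?m + ?m * z istar) = q * X * S"
      unfolding eq[symmetric] by (simp add: algebra_simps)
    then have "?t = q * X * S / (?m + ?m * z istar)"
      by (simp only: nonzero_eq_divide_eq[OF nz])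
    then show ?thesis by simp
  qed
  show ?thesis
    unfolding X_def[symmetric]
  proof (intro conjI impI)
    assume p: "1 \<le> p \<and> p \<le> 2 * a istar \<and> odd p"
    then have p': "1 \<le> p" "p \<le> m istar" using m[OF istar] by auto
    \<comment> \<open>An odd label is \<open>2 * (s + 1) - 1\<close>, so the root is the tail of the
      arc with index \<open>s + 1\<close>.\<close>
    from p obtain s where s: "p = 2 * s + 1" by (auto elim: oddE)
    then have "(v istar p, v istar (p + 1)) \<in> parcs (H istar)"
      using p unfolding H_arcs[OF istar] by (auto intro!: exI[of _ "s + 1"])
    then have "(?r, (istar, v istar (p + 1))) \<in> join_inner_arcs G H"
      using istar by (simp add: join_inner_arcs_iff)
    from matched_blowup.forest_sum_root_tail[OF blowup[OF p'] this]
    have "(1 + z istar) * (?m * ?t) = z istar * X * S"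
      by (simp add: count[OF p'] factor[OF p'] z S)
    then show "?t = z istar / (?m + ?m * z istar) * X * S" by (rule solve)
  next
    assume p: "1 \<le> p \<and> p \<le> 2 * a istar \<and> even p"
    then have p': "1 \<le> p" "p \<le> m istar" using m[OF istar] by auto
    \<comment> \<open>An even label makes the root the head of the arc with index
      \<open>s\<close>.\<close>
    from p obtain s where s: "p = 2 * s" by (auto elim: evenE)
    then have "(v istar (p - 1), v istar p) \<in> parcs (H istar)"
      using p unfolding H_arcs[OF istar] by (auto intro!: exI[of _ s])
    then have "((istar, v istar (p - 1)), ?r) \<in> join_inner_arcs G H"
      using istar by (simp add: join_inner_arcs_iff)
    from matched_blowup.forest_sum_root_head[OF blowup[OF p'] this]
    \<comment> \<open>With unit weights, the numerator of the case of a root that is a head becomes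
      \<open>(1 + z) + 1\<close>.\<close>
    have "(1 + z istar) * (?m * ?t) = (2 + z istar) * X * S"
      by (simp add: count[OF p'] factor[OF p'] z S)
    then show "?t = (2 + z istar) / (?m + ?m * z istar) * X * S" by (rule solve)
  next
    assume p: "2 * a istar + 1 \<le> p \<and> p \<le> m istar"
    then have p': "1 \<le> p" "p \<le> m istar" by auto
    have "?r \<notin> Field (join_inner_arcs G H)"
    proof
      assume "?r \<in> Field (join_inner_arcs G H)"
      then obtain u where "(v istar p, u) \<in> parcs (H istar) \<or> (u, v istar p) \<in> parcs (H istar)"
        by (auto simp: Field_def join_inner_arcs_def)
      \<comment> \<open>Matched vertices have labels up to \<open>2 * a istar\<close>, and labels
        are injective, whereas \<open>p\<close> lies beyond this bound.\<close>
      then obtain q where q: "v istar p = v istar q" "1 \<le> q" "q \<le> 2 * a istar"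
        unfolding H_arcs[OF istar] by fastforce
      then have "p = q" using inj_onD[OF inj[OF istar] q(1)] p p' size[OF istar] by auto
      with p q show False by auto
    qed
    from forest_sum_matched_blowup[OF blowup[OF p'] this]
    have "?m * ?t = X * S"
      by (simp add: count[OF p'] factor[OF p'] z S)
    moreover have "?m \<noteq> 0" using pos by (metis less_irrefl mult_zero_left)
    ultimately show "?t = 1 / ?m * X * S" by (simp add: field_simps)
  qed
qed

end
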